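(* Let $I$ be an ideal of a valuation ring $V$ of finite Krull dimension, and let $\Gamma_I$ be the $I$-torsion functor. Then for all $V$-modules $M$ and all $i \geq 3$, $R^i\Gamma_I(M) = 0$.
   Context: Rings are commutative with identity. $\mathbb N$ denotes the positive integers. For a ring $A$ and an ideal $I \subset A$, the $I$-torsion functor $\Gamma_I$ on $A$-modules is $\Gamma_I(M) = \{m \in M : \exists\, n \in \mathbb N \text{ such that } I^n m = 0\}$. It is left exact, and its right derived functors are denoted $R^i\Gamma_I$, $i \ge 0$ (the $I$-torsion cohomology functors). *)

theory Defs
  imports "HOL-Algebra.Ideal_Product" "HOL-Algebra.Module" "HOL-Algebra.Divisibility"
    "HOL-Library.Extended_Nat"
begin

text \<open>Valuation rings are domains; fields are included. The divisibility condition says that for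
  every nonzero element \<open>x = b / a\<close> of the fraction field, \<open>x\<close> or its inverse lies in the ring.\<close>

locale valuation_ring = "domain" R for R (structure) +
  assumes divides_total:
    "\<lbrakk>a \<in> carrier R; b \<in> carrier R\<rbrakk> \<Longrightarrow> a divides b \<or> b divides a"

definition krull_dim :: "('a, 'b) ring_scheme \<Rightarrow> enat" where
  "krull_dim R = Sup (enat ` {n. \<exists>P :: nat \<Rightarrow> 'a set.
     (\<forall>k\<le>n. primeideal (P k) R) \<and> (\<forall>k<n. P k \<subset> P (Suc k))})"

definition linear_maps ::
    "('a, 'b) ring_scheme \<Rightarrow> ('a, 'm, 'c) module_scheme \<Rightarrow> ('a, 'n, 'd) module_scheme \<Rightarrow> ('m \<Rightarrow> 'n) set" where
  "linear_maps R M N = {f \<in> carrier M \<rightarrow> carrier N.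
     (\<forall>x\<in>carrier M. \<forall>y\<in>carrier M. f (x \<oplus>\<^bsub>M\<^esub> y) = f x \<oplus>\<^bsub>N\<^esub> f y) \<and>
     (\<forall>a\<in>carrier R. \<forall>x\<in>carrier M. f (a \<odot>\<^bsub>M\<^esub> x) = a \<odot>\<^bsub>N\<^esub> f x)}"

text \<open>The type of \<open>f\<close> does not record its domain, hence the module \<open>M\<close> is an argument.\<close>

definition linear_kernel ::
    "('a, 'm, 'c) module_scheme \<Rightarrow> ('a, 'n, 'd) module_scheme \<Rightarrow> ('m \<Rightarrow> 'n) \<Rightarrow> 'm set" where
  "linear_kernel M N f = {x \<in> carrier M. f x = \<zero>\<^bsub>N\<^esub>}"

text \<open>The components \<open>mult\<close> and \<open>one\<close> of a module record carry no meaning.\<close>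

definition quotient_module :: "('a, 'm, 'c) module_scheme \<Rightarrow> 'm set \<Rightarrow> ('a, 'm set) module" where
  "quotient_module M N =
     \<lparr>carrier = a_rcosets\<^bsub>M\<^esub> N, monoid.mult = undefined, one = undefined,
      zero = N, add = set_add M,
      smult = (\<lambda>a X. \<Union>x\<in>X. N +>\<^bsub>M\<^esub> (a \<odot>\<^bsub>M\<^esub> x))\<rparr>"

text \<open>HOL cannot quantify over types inside a formula, so the monomorphisms \<open>A \<rightarrow> B\<close> range over the
  modules whose elements lie in \<open>'a + 'e\<close>, a type containing copies of the ring and of \<open>E\<close>. The
  lemma \<open>injective_module_extend\<close> below (via Baer's argument) shows that extension
  along monomorphisms between modules of arbitrary types follows.\<close>

definition injective_module :: "('a, 'b) ring_scheme \<Rightarrow> ('a, 'e) module \<Rightarrow> bool" where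
  "injective_module R E \<longleftrightarrow> Module.module R E \<and>
     (\<forall>(A :: ('a, 'a + 'e) module) (B :: ('a, 'a + 'e) module) f g.
        Module.module R A \<and> Module.module R B \<and> f \<in> linear_maps R A B \<and> inj_on f (carrier A) \<and>
        g \<in> linear_maps R A E \<longrightarrow>
        (\<exists>h \<in> linear_maps R B E. \<forall>x\<in>carrier A. h (f x) = g x))"

text \<open>Exactness of \<open>0 \<rightarrow> M \<rightarrow> E 0 \<rightarrow> E 1 \<rightarrow> \<dots>\<close> with all \<open>E n\<close> injective; \<open>\<epsilon>\<close> is the
  augmentation and \<open>d n\<close> the differential from \<open>E n\<close> to \<open>E (Suc n)\<close>. Using one type \<open>'e\<close> for all
  \<open>E n\<close> is no restriction, as countably many modules can be moved into a common type.\<close>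

definition injective_resolution ::
    "('a, 'b) ring_scheme \<Rightarrow> ('a, 'm, 'c) module_scheme \<Rightarrow> ('m \<Rightarrow> 'e) \<Rightarrow>
     (nat \<Rightarrow> ('a, 'e) module) \<Rightarrow> (nat \<Rightarrow> 'e \<Rightarrow> 'e) \<Rightarrow> bool" where
  "injective_resolution R M \<epsilon> E d \<longleftrightarrow>
     Module.module R M \<and>
     (\<forall>n. injective_module R (E n)) \<and>
     \<epsilon> \<in> linear_maps R M (E 0) \<and> (\<forall>n. d n \<in> linear_maps R (E n) (E (Suc n))) \<and>
     inj_on \<epsilon> (carrier M) \<and>
     \<epsilon> ` carrier M = linear_kernel (E 0) (E 1) (d 0) \<and>
     (\<forall>n. d n ` carrier (E n) = linear_kernel (E (Suc n)) (E (Suc (Suc n))) (d (Suc n)))"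

text \<open>A cochain complex in degrees \<open>\<ge> 0\<close>: nothing maps into degree \<open>0\<close>.\<close>

definition coboundaries :: "(nat \<Rightarrow> ('a, 'e) module) \<Rightarrow> (nat \<Rightarrow> 'e \<Rightarrow> 'e) \<Rightarrow> nat \<Rightarrow> 'e set" where
  "coboundaries C d i = (case i of 0 \<Rightarrow> {\<zero>\<^bsub>C 0\<^esub>} | Suc j \<Rightarrow> d j ` carrier (C j))"

definition cohomology_module ::
    "(nat \<Rightarrow> ('a, 'e) module) \<Rightarrow> (nat \<Rightarrow> 'e \<Rightarrow> 'e) \<Rightarrow> nat \<Rightarrow> ('a, 'e set) module" where
  "cohomology_module C d i =
     quotient_module (C i\<lparr>carrier := linear_kernel (C i) (C (Suc i)) (d i)\<rparr>) (coboundaries C d i)"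

definition torsion :: "('a, 'b) ring_scheme \<Rightarrow> 'a set \<Rightarrow> ('a, 'm, 'c) module_scheme \<Rightarrow> ('a, 'm, 'c) module_scheme" where
  "torsion R I M = M\<lparr>carrier := {m \<in> carrier M.
     \<exists>n::nat. n \<ge> 1 \<and> (\<forall>a \<in> I [^]\<^bsub>ideals_set R\<^esub> n. a \<odot>\<^bsub>M\<^esub> m = \<zero>\<^bsub>M\<^esub>)}\<rparr>"

text \<open>For an injective resolution \<open>(\<epsilon>, E, d)\<close> of \<open>M\<close> this is \<open>R\<^sup>i\<Gamma>\<^sub>I(M)\<close>, the cohomology of the complex
  \<open>\<Gamma>\<^sub>I(E 0) \<rightarrow> \<Gamma>\<^sub>I(E 1) \<rightarrow> \<dots>\<close>. The functor acts on maps by restriction, so the differentials are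
  still given by \<open>d\<close>.\<close>

definition torsion_cohomology ::
    "('a, 'b) ring_scheme \<Rightarrow> 'a set \<Rightarrow> (nat \<Rightarrow> ('a, 'e) module) \<Rightarrow> (nat \<Rightarrow> 'e \<Rightarrow> 'e) \<Rightarrow>
     nat \<Rightarrow> ('a, 'e set) module" where
  "torsion_cohomology R I E d i = cohomology_module (\<lambda>n. torsion R I (E n)) d i"


subsection \<open>Injectivity does not depend on the types of the test modules\<close>

definition Inl_ideal :: "('a, 'b) ring_scheme \<Rightarrow> 'a set \<Rightarrow> ('a, 'a + 'e) module" where
  "Inl_ideal R J =
     \<lparr>carrier = Inl ` J, monoid.mult = undefined, one = undefined, zero = Inl \<zero>\<^bsub>R\<^esub>,
      add = (\<lambda>x y. Inl (projl x \<oplus>\<^bsub>R\<^esub> projl y)), smult = (\<lambda>a x. Inl (a \<otimes>\<^bsub>R\<^esub> projl x))\<rparr>"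

lemma module_Inl_ideal:
  assumes "cring R" "ideal J R"
  shows "Module.module R (Inl_ideal R J :: ('a, 'a + 'e) module)"
proof -
  interpret cring R by fact
  interpret J: ideal J R by fact
  note [simp] = J.Icarr
  show ?thesis
  proof (rule moduleI)
    show "abelian_group (Inl_ideal R J :: ('a, 'a + 'e) module)"
    proof (rule abelian_groupI)
      fix x assume "x \<in> carrier (Inl_ideal R J :: ('a, 'a + 'e) module)"
      then obtain j where j: "j \<in> J" "x = Inl j" by (auto simp: Inl_ideal_def)
      have "\<ominus>\<^bsub>R\<^esub> j \<in> J" "\<ominus>\<^bsub>R\<^esub> j \<oplus>\<^bsub>R\<^esub> j = \<zero>\<^bsub>R\<^esub>" using j by (auto simp: l_neg)
      then show "\<exists>y\<in>carrier (Inl_ideal R J). y \<oplus>\<^bsub>Inl_ideal R J\<^esub> x = \<zero>\<^bsub>Inl_ideal R J\<^esub>"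
        using j by (auto simp: Inl_ideal_def)
    qed (auto simp: Inl_ideal_def a_ac)
  qed (use assms in \<open>auto simp: Inl_ideal_def l_distr r_distr m_assoc J.I_l_closed\<close>)
qed

lemma injective_module_ideal_extend:
  assumes E: "injective_module R E" and J: "ideal J R"
    and \<phi>: "\<phi> \<in> J \<rightarrow> carrier E"
    and add: "\<And>x y. \<lbrakk>x \<in> J; y \<in> J\<rbrakk> \<Longrightarrow> \<phi> (x \<oplus>\<^bsub>R\<^esub> y) = \<phi> x \<oplus>\<^bsub>E\<^esub> \<phi> y"
    and smult: "\<And>a x. \<lbrakk>a \<in> carrier R; x \<in> J\<rbrakk> \<Longrightarrow> \<phi> (a \<otimes>\<^bsub>R\<^esub> x) = a \<odot>\<^bsub>E\<^esub> \<phi> x"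
  shows "\<exists>e\<in>carrier E. \<forall>x\<in>J. \<phi> x = x \<odot>\<^bsub>E\<^esub> e"
proof -
  have mE: "Module.module R E" using E by (simp add: injective_module_def)
  interpret E: Module.module R E by fact
  interpret J: ideal J R by fact
  have cR: "cring R" by (rule E.R.cring_axioms)
  let ?A = "Inl_ideal R J :: ('a, 'a + 'c) module"
  let ?B = "Inl_ideal R (carrier R) :: ('a, 'a + 'c) module"
  have A: "Module.module R ?A" by (rule module_Inl_ideal[OF cR J])
  have B: "Module.module R ?B" by (rule module_Inl_ideal[OF cR E.R.oneideal])
  have f: "(\<lambda>x. x) \<in> linear_maps R ?A ?B"
    by (auto simp: linear_maps_def Inl_ideal_def J.Icarr)
  have g: "\<phi> \<circ> projl \<in> linear_maps R ?A E"
    using \<phi> by (auto simp: linear_maps_def Inl_ideal_def add smult)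
  obtain h where h: "h \<in> linear_maps R ?B E" "\<forall>x\<in>carrier ?A. h x = (\<phi> \<circ> projl) x"
    using E A B f g unfolding injective_module_def by (metis inj_on_id2)
  have "h (Inl \<one>\<^bsub>R\<^esub>) \<in> carrier E"
    using h(1) by (auto simp: linear_maps_def Inl_ideal_def)
  moreover have "\<phi> x = x \<odot>\<^bsub>E\<^esub> h (Inl \<one>\<^bsub>R\<^esub>)" if "x \<in> J" for x
  proof -
    have "\<phi> x = h (Inl x)" using h(2) that by (auto simp: Inl_ideal_def)
    also have "Inl x = x \<odot>\<^bsub>?B\<^esub> Inl \<one>\<^bsub>R\<^esub>" using that by (simp add: Inl_ideal_def J.Icarr)
    also have "h \<dots> = x \<odot>\<^bsub>E\<^esub> h (Inl \<one>\<^bsub>R\<^esub>)"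
      proof -
      have "Inl \<one>\<^bsub>R\<^esub> \<in> carrier ?B" by (simp add: Inl_ideal_def)
      then show ?thesis using h(1) J.Icarr[OF that] unfolding linear_maps_def by blast
    qed
    finally show ?thesis .
  qed
  ultimately show ?thesis by blast
qed

text \<open>Graphs of linear maps from submodules of \<open>B\<close> to \<open>E\<close>.\<close>

definition partial_graph ::
    "('a, 'b) ring_scheme \<Rightarrow> ('a, 'm, 'c) module_scheme \<Rightarrow> ('a, 'e, 'd) module_scheme \<Rightarrow> ('m \<times> 'e) set \<Rightarrow> bool" where
  "partial_graph R B E G \<longleftrightarrow> G \<subseteq> carrier B \<times> carrier E \<and> (\<zero>\<^bsub>B\<^esub>, \<zero>\<^bsub>E\<^esub>) \<in> G \<and>
     (\<forall>x y x' y'. (x, y) \<in> G \<longrightarrow> (x', y') \<in> G \<longrightarrow> (x \<oplus>\<^bsub>B\<^esub> x', y \<oplus>\<^bsub>E\<^esub> y') \<in> G) \<and>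
     (\<forall>a\<in>carrier R. \<forall>x y. (x, y) \<in> G \<longrightarrow> (a \<odot>\<^bsub>B\<^esub> x, a \<odot>\<^bsub>E\<^esub> y) \<in> G) \<and>
     (\<forall>y. (\<zero>\<^bsub>B\<^esub>, y) \<in> G \<longrightarrow> y = \<zero>\<^bsub>E\<^esub>)"

lemma partial_graph_minus:
  assumes "Module.module R B" "Module.module R E" "partial_graph R B E G" "(x, y) \<in> G" "(x', y') \<in> G"
  shows "(x \<ominus>\<^bsub>B\<^esub> x', y \<ominus>\<^bsub>E\<^esub> y') \<in> G"
proof -
  interpret B: Module.module R B by fact
  interpret E: Module.module R E by fact
  have c: "x' \<in> carrier B" "y' \<in> carrier E" using assms unfolding partial_graph_def by auto
  have "\<ominus>\<^bsub>R\<^esub> \<one>\<^bsub>R\<^esub> \<in> carrier R" by simp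
  then have "((\<ominus>\<^bsub>R\<^esub> \<one>\<^bsub>R\<^esub>) \<odot>\<^bsub>B\<^esub> x', (\<ominus>\<^bsub>R\<^esub> \<one>\<^bsub>R\<^esub>) \<odot>\<^bsub>E\<^esub> y') \<in> G"
    using assms(3,5) unfolding partial_graph_def by blast
  then have "(\<ominus>\<^bsub>B\<^esub> x', \<ominus>\<^bsub>E\<^esub> y') \<in> G"
    using c by (simp add: B.smult_l_minus E.smult_l_minus)
  then show ?thesis
    using assms(3,4) unfolding partial_graph_def a_minus_def by blast
qed

lemma partial_graph_unique:
  assumes "Module.module R B" "Module.module R E" "partial_graph R B E G" "(x, y) \<in> G" "(x, y') \<in> G"
  shows "y = y'"
proof -
  interpret B: Module.module R B by fact
  interpret E: Module.module R E by fact
  have c: "x \<in> carrier B" "y \<in> carrier E" "y' \<in> carrier E"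
    using assms unfolding partial_graph_def by auto
  have "(x \<ominus>\<^bsub>B\<^esub> x, y \<ominus>\<^bsub>E\<^esub> y') \<in> G" using partial_graph_minus[OF assms] .
  then have "y \<ominus>\<^bsub>E\<^esub> y' = \<zero>\<^bsub>E\<^esub>"
    using assms(3) c unfolding partial_graph_def by (simp add: a_minus_def B.M.r_neg)
  then show ?thesis using c
    by (metis E.M.minus_equality E.M.minus_eq E.M.minus_minus E.M.a_inv_closed)
qed

lemma injective_module_extend:
  fixes A :: "('a, 'm, 'c) module_scheme" and B :: "('a, 'n, 'd) module_scheme"
    and E :: "('a, 'e) module"
  assumes E: "injective_module R E" and A: "Module.module R A" and B: "Module.module R B"
    and f: "f \<in> linear_maps R A B" "inj_on f (carrier A)" and g: "g \<in> linear_maps R A E"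
  shows "\<exists>h \<in> linear_maps R B E. \<forall>x\<in>carrier A. h (f x) = g x"
proof -
  have mE: "Module.module R E" using E by (simp add: injective_module_def)
  interpret A: Module.module R A by fact
  interpret B: Module.module R B by fact
  interpret E: Module.module R E by fact
  have fc: "f x \<in> carrier B" and gc: "g x \<in> carrier E" if "x \<in> carrier A" for x
    using f(1) g that by (auto simp: linear_maps_def)
  have lin: "f (x \<oplus>\<^bsub>A\<^esub> y) = f x \<oplus>\<^bsub>B\<^esub> f y" "g (x \<oplus>\<^bsub>A\<^esub> y) = g x \<oplus>\<^bsub>E\<^esub> g y"
    if "x \<in> carrier A" "y \<in> carrier A" for x y
    using f(1) g that by (auto simp: linear_maps_def)
  have sm: "f (a \<odot>\<^bsub>A\<^esub> x) = a \<odot>\<^bsub>B\<^esub> f x" "g (a \<odot>\<^bsub>A\<^esub> x) = a \<odot>\<^bsub>E\<^esub> g x"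
    if "a \<in> carrier R" "x \<in> carrier A" for a x
    using f(1) g that by (auto simp: linear_maps_def)
  have z: "f \<zero>\<^bsub>A\<^esub> = \<zero>\<^bsub>B\<^esub>" "g \<zero>\<^bsub>A\<^esub> = \<zero>\<^bsub>E\<^esub>"
    using sm[of "\<zero>\<^bsub>R\<^esub>" "\<zero>\<^bsub>A\<^esub>"] fc gc by auto
  define G0 where "G0 = (\<lambda>x. (f x, g x)) ` carrier A"
  have G0: "partial_graph R B E G0"
    unfolding partial_graph_def
  proof (intro conjI allI impI ballI)
    show "G0 \<subseteq> carrier B \<times> carrier E" using fc gc by (auto simp: G0_def)
    show "(\<zero>\<^bsub>B\<^esub>, \<zero>\<^bsub>E\<^esub>) \<in> G0" unfolding G0_def using z by (intro image_eqI[of _ _ "\<zero>\<^bsub>A\<^esub>"]) auto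
    fix y assume "(\<zero>\<^bsub>B\<^esub>, y) \<in> G0"
    then obtain x where x: "x \<in> carrier A" "f x = \<zero>\<^bsub>B\<^esub>" "y = g x" by (auto simp: G0_def)
    then have "x = \<zero>\<^bsub>A\<^esub>" using f(2) z by (metis A.M.zero_closed inj_onD)
    then show "y = \<zero>\<^bsub>E\<^esub>" using x z by simp
  next
    fix x y x' y' assume "(x, y) \<in> G0" "(x', y') \<in> G0"
    then obtain u v where "u \<in> carrier A" "v \<in> carrier A" "x = f u" "y = g u" "x' = f v" "y' = g v"
      by (auto simp: G0_def)
    then show "(x \<oplus>\<^bsub>B\<^esub> x', y \<oplus>\<^bsub>E\<^esub> y') \<in> G0"
      unfolding G0_def by (intro image_eqI[of _ _ "u \<oplus>\<^bsub>A\<^esub> v"]) (auto simp: lin)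
  next
    fix a x y assume a: "a \<in> carrier R" and "(x, y) \<in> G0"
    then obtain u where "u \<in> carrier A" "x = f u" "y = g u"
      by (auto simp: G0_def)
    then show "(a \<odot>\<^bsub>B\<^esub> x, a \<odot>\<^bsub>E\<^esub> y) \<in> G0"
      unfolding G0_def using a by (intro image_eqI[of _ _ "a \<odot>\<^bsub>A\<^esub> u"]) (auto simp: sm)
  qed
  define S where "S = {G. partial_graph R B E G \<and> G0 \<subseteq> G}"
  have "\<exists>G\<in>S. \<forall>X\<in>S. G \<subseteq> X \<longrightarrow> X = G"
  proof (rule subset_Zorn_nonempty)
    show "S \<noteq> {}" using G0 by (auto simp: S_def)
    fix C assume C: "C \<noteq> {}" "subset.chain S C"
    have CS: "\<And>G. G \<in> C \<Longrightarrow> partial_graph R B E G \<and> G0 \<subseteq> G"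
      using C(2) by (auto simp: S_def subset.chain_def)
    have tot: "\<exists>G\<in>C. p \<in> G \<and> q \<in> G" if "p \<in> \<Union>C" "q \<in> \<Union>C" for p q
    proof -
      from that obtain X Y where "X \<in> C" "Y \<in> C" "p \<in> X" "q \<in> Y" by blast
      then show ?thesis using subset_chain_def[THEN iffD1, OF C(2)] by blast
    qed
    have "partial_graph R B E (\<Union>C)"
      unfolding partial_graph_def
    proof (intro conjI allI impI ballI)
      show "\<Union>C \<subseteq> carrier B \<times> carrier E" using CS unfolding partial_graph_def by blast
      show "(\<zero>\<^bsub>B\<^esub>, \<zero>\<^bsub>E\<^esub>) \<in> \<Union>C" using C(1) CS unfolding partial_graph_def by blast
      show "y = \<zero>\<^bsub>E\<^esub>" if "(\<zero>\<^bsub>B\<^esub>, y) \<in> \<Union>C" for y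
        using that CS unfolding partial_graph_def by blast
    next
      fix x y x' y' assume "(x, y) \<in> \<Union>C" "(x', y') \<in> \<Union>C"
      then obtain G where "G \<in> C" "(x, y) \<in> G" "(x', y') \<in> G" using tot by meson
      then show "(x \<oplus>\<^bsub>B\<^esub> x', y \<oplus>\<^bsub>E\<^esub> y') \<in> \<Union>C"
        using CS unfolding partial_graph_def by blast
    next
      fix a x y assume "a \<in> carrier R" "(x, y) \<in> \<Union>C"
      then show "(a \<odot>\<^bsub>B\<^esub> x, a \<odot>\<^bsub>E\<^esub> y) \<in> \<Union>C"
        using CS unfolding partial_graph_def by blast
    qed
    moreover have "G0 \<subseteq> \<Union>C" using C(1) CS by blast
    ultimately show "\<Union>C \<in> S" by (simp add: S_def)
  qed
  then obtain G where GS: "G \<in> S" and maxS: "\<forall>X\<in>S. G \<subseteq> X \<longrightarrow> X = G"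
    by (elim bexE)
  have G: "partial_graph R B E G" "G0 \<subseteq> G" using GS by (simp_all add: S_def)
  have max: "X = G" if "partial_graph R B E X" "G0 \<subseteq> X" "G \<subseteq> X" for X
    using maxS that by (simp add: S_def)
  have Gc: "x \<in> carrier B" "y \<in> carrier E" if "(x, y) \<in> G" for x y
    using G(1) that unfolding partial_graph_def by auto
  have Gz: "(\<zero>\<^bsub>B\<^esub>, \<zero>\<^bsub>E\<^esub>) \<in> G" using G(1) unfolding partial_graph_def by blast
  have Ga: "(x \<oplus>\<^bsub>B\<^esub> x', y \<oplus>\<^bsub>E\<^esub> y') \<in> G" if "(x, y) \<in> G" "(x', y') \<in> G" for x y x' y'
    using G(1) that unfolding partial_graph_def by blast
  have Gs: "(a \<odot>\<^bsub>B\<^esub> x, a \<odot>\<^bsub>E\<^esub> y) \<in> G" if "a \<in> carrier R" "(x, y) \<in> G" for a x y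
    using G(1) that unfolding partial_graph_def by blast
  note Gu = partial_graph_unique[OF B mE G(1)]
  note Gm = partial_graph_minus[OF B mE G(1)]
  have dom: "\<exists>y. (b, y) \<in> G" if b: "b \<in> carrier B" for b
  proof -
    define J where "J = {r \<in> carrier R. \<exists>y. (r \<odot>\<^bsub>B\<^esub> b, y) \<in> G}"
    define \<phi> where "\<phi> r = (THE y. (r \<odot>\<^bsub>B\<^esub> b, y) \<in> G)" for r
    have \<phi>: "\<phi> r = y" if "(r \<odot>\<^bsub>B\<^esub> b, y) \<in> G" for r y
      unfolding \<phi>_def using that Gu by blast
    have \<phi>G: "(r \<odot>\<^bsub>B\<^esub> b, \<phi> r) \<in> G" "r \<in> carrier R" if "r \<in> J" for r
      using that \<phi> by (auto simp: J_def)
    have add: "((r \<oplus>\<^bsub>R\<^esub> s) \<odot>\<^bsub>B\<^esub> b, \<phi> r \<oplus>\<^bsub>E\<^esub> \<phi> s) \<in> G" if "r \<in> J" "s \<in> J" for r s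
      using Ga[OF \<phi>G(1)[OF that(1)] \<phi>G(1)[OF that(2)]] b \<phi>G(2) that by (simp add: B.smult_l_distr)
    have sml: "((a \<otimes>\<^bsub>R\<^esub> r) \<odot>\<^bsub>B\<^esub> b, a \<odot>\<^bsub>E\<^esub> \<phi> r) \<in> G" if "a \<in> carrier R" "r \<in> J" for a r
      using Gs[OF that(1) \<phi>G(1)[OF that(2)]] b \<phi>G(2) that by (simp add: B.smult_assoc1)
    have J: "ideal J R"
    proof (rule idealI)
      show "ring R" by (rule A.R.ring_axioms)
      show "subgroup J (add_monoid R)"
      proof (rule A.R.add.subgroupI)
        show "J \<subseteq> carrier R" by (auto simp: J_def)
        show "J \<noteq> {}" using Gz b by (auto simp: J_def intro!: exI[of _ "\<zero>\<^bsub>R\<^esub>"])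
        show "r \<oplus>\<^bsub>R\<^esub> s \<in> J" if "r \<in> J" "s \<in> J" for r s
          using add[OF that] \<phi>G(2) that by (auto simp: J_def)
        show "\<ominus>\<^bsub>R\<^esub> r \<in> J" if "r \<in> J" for r
        proof -
          have "(\<ominus>\<^bsub>R\<^esub> \<one>\<^bsub>R\<^esub>) \<otimes>\<^bsub>R\<^esub> r = \<ominus>\<^bsub>R\<^esub> r"
            using \<phi>G(2)[OF that] by (simp add: A.R.l_minus)
          then show ?thesis using sml[of "\<ominus>\<^bsub>R\<^esub> \<one>\<^bsub>R\<^esub>" r] \<phi>G(2)[OF that] that by (auto simp: J_def)
        qed
      qed
      show "x \<otimes>\<^bsub>R\<^esub> r \<in> J" if "r \<in> J" "x \<in> carrier R" for r x
        using sml[OF that(2,1)] \<phi>G(2) that by (auto simp: J_def)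
      then show "r \<otimes>\<^bsub>R\<^esub> x \<in> J" if "r \<in> J" "x \<in> carrier R" for r x
        using that \<phi>G(2) by (metis A.R.m_comm)
    qed
    obtain e where e: "e \<in> carrier E" "\<And>r. r \<in> J \<Longrightarrow> \<phi> r = r \<odot>\<^bsub>E\<^esub> e"
      using injective_module_ideal_extend[OF E J, of \<phi>] \<phi> add sml \<phi>G Gc by (metis Pi_I)
    define X where "X = {(x \<oplus>\<^bsub>B\<^esub> r \<odot>\<^bsub>B\<^esub> b, y \<oplus>\<^bsub>E\<^esub> r \<odot>\<^bsub>E\<^esub> e) | x y r. (x, y) \<in> G \<and> r \<in> carrier R}"
    have XI: "(u, v) \<in> X"
      if "(x, y) \<in> G" "r \<in> carrier R" "u = x \<oplus>\<^bsub>B\<^esub> r \<odot>\<^bsub>B\<^esub> b" "v = y \<oplus>\<^bsub>E\<^esub> r \<odot>\<^bsub>E\<^esub> e" for u v x y r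
      using that unfolding X_def by blast
    have GX: "G \<subseteq> X"
    proof
      fix p assume "p \<in> G"
      then show "p \<in> X" using XI[of "fst p" "snd p" "\<zero>\<^bsub>R\<^esub>" "fst p" "snd p"] Gc[of "fst p" "snd p"] b e(1)
        by simp
    qed
    have "partial_graph R B E X"
      unfolding partial_graph_def
    proof (intro conjI allI impI ballI)
      show "X \<subseteq> carrier B \<times> carrier E" using Gc b e(1) unfolding X_def by auto
      show "(\<zero>\<^bsub>B\<^esub>, \<zero>\<^bsub>E\<^esub>) \<in> X" using GX Gz by blast
    next
      fix v assume "(\<zero>\<^bsub>B\<^esub>, v) \<in> X"
      then obtain x y r where xyr: "(x, y) \<in> G" "r \<in> carrier R"
          "x \<oplus>\<^bsub>B\<^esub> r \<odot>\<^bsub>B\<^esub> b = \<zero>\<^bsub>B\<^esub>" "v = y \<oplus>\<^bsub>E\<^esub> r \<odot>\<^bsub>E\<^esub> e" unfolding X_def by auto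
      have c: "x \<in> carrier B" "y \<in> carrier E" using Gc xyr(1) by auto
      have rb: "r \<odot>\<^bsub>B\<^esub> b = \<zero>\<^bsub>B\<^esub> \<ominus>\<^bsub>B\<^esub> x"
        using xyr(2,3) c b by (metis B.M.a_comm B.M.minus_equality B.M.minus_eq B.M.l_zero B.M.a_inv_closed B.smult_closed)
      have "(r \<odot>\<^bsub>B\<^esub> b, \<zero>\<^bsub>E\<^esub> \<ominus>\<^bsub>E\<^esub> y) \<in> G" unfolding rb by (rule Gm[OF Gz xyr(1)])
      then have "r \<in> J" "\<phi> r = \<zero>\<^bsub>E\<^esub> \<ominus>\<^bsub>E\<^esub> y" using xyr(2) \<phi> by (auto simp: J_def)
      then have "r \<odot>\<^bsub>E\<^esub> e = \<ominus>\<^bsub>E\<^esub> y" using e(2) c by (simp add: a_minus_def)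
      then show "v = \<zero>\<^bsub>E\<^esub>" using xyr(4) c by (simp add: E.M.r_neg)
    next
      fix u v u' v' assume "(u, v) \<in> X" "(u', v') \<in> X"
      then obtain x y r x' y' r' where xyr: "(x, y) \<in> G" "r \<in> carrier R"
          "u = x \<oplus>\<^bsub>B\<^esub> r \<odot>\<^bsub>B\<^esub> b" "v = y \<oplus>\<^bsub>E\<^esub> r \<odot>\<^bsub>E\<^esub> e" "(x', y') \<in> G" "r' \<in> carrier R"
          "u' = x' \<oplus>\<^bsub>B\<^esub> r' \<odot>\<^bsub>B\<^esub> b" "v' = y' \<oplus>\<^bsub>E\<^esub> r' \<odot>\<^bsub>E\<^esub> e"
        unfolding X_def by auto
      show "(u \<oplus>\<^bsub>B\<^esub> u', v \<oplus>\<^bsub>E\<^esub> v') \<in> X"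
        by (rule XI[OF Ga[OF xyr(1,5)], of "r \<oplus>\<^bsub>R\<^esub> r'"])
          (use xyr b e(1) Gc[OF xyr(1)] Gc[OF xyr(5)] in
            \<open>simp_all add: B.smult_l_distr E.smult_l_distr B.M.a_ac E.M.a_ac\<close>)
    next
      fix a u v assume a: "a \<in> carrier R" and "(u, v) \<in> X"
      then obtain x y r where xyr: "(x, y) \<in> G" "r \<in> carrier R"
          "u = x \<oplus>\<^bsub>B\<^esub> r \<odot>\<^bsub>B\<^esub> b" "v = y \<oplus>\<^bsub>E\<^esub> r \<odot>\<^bsub>E\<^esub> e"
        unfolding X_def by auto
      show "(a \<odot>\<^bsub>B\<^esub> u, a \<odot>\<^bsub>E\<^esub> v) \<in> X"
        by (rule XI[OF Gs[OF a xyr(1)], of "a \<otimes>\<^bsub>R\<^esub> r"])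
          (use a xyr b e(1) Gc[OF xyr(1)] in
            \<open>simp_all add: B.smult_r_distr E.smult_r_distr B.smult_assoc1 E.smult_assoc1\<close>)
    qed
    then have "X = G" using max GX G(2) by blast
    moreover have "(b, e) \<in> X"
      by (rule XI[OF Gz, of "\<one>\<^bsub>R\<^esub>"]) (use b e(1) in simp_all)
    ultimately show ?thesis by blast
  qed
  define h where "h x = (THE y. (x, y) \<in> G)" for x
  have h: "h x = y" if "(x, y) \<in> G" for x y
    unfolding h_def using that Gu by blast
  have hG: "(x, h x) \<in> G" if "x \<in> carrier B" for x
    using dom[OF that] h by auto
  have "h \<in> linear_maps R B E"
    unfolding linear_maps_def using Gc(2)[OF hG] hG by (auto intro!: h Ga Gs)
  moreover have "\<forall>x\<in>carrier A. h (f x) = g x"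
    using G(2) h by (auto simp: G0_def)
  ultimately show ?thesis by blast
qed

end

theory Submission
  imports Defs
begin

text \<open>Every nonzero ideal of a finite-dimensional valuation ring \<open>V\<close> has the form \<open>\<Union>\<^sub>k a\<^sub>k V\<close> with
  \<open>a\<^sub>k\<^sub>+\<^sub>1\<close> dividing \<open>a\<^sub>k\<close>, since its value group is a finite iterated extension of archimedean
  groups. Such an ideal \<open>J\<close> is a countable direct limit of free modules of rank one, so \<open>V/J\<close> has
  projective dimension at most 2, and \<open>R\<^sup>i\<Gamma>\<^sub>I\<close> is the direct limit of the functors
  \<open>Ext\<^sup>i(V/I\<^sup>n, -)\<close>. Explicitly, let \<open>x = d y\<^sub>0\<close> be a cocycle of degree at least 3 killed by
  \<open>J = I\<^sup>n\<close>. Divisibility of injectives allows one to choose \<open>z\<^sub>k\<close> with \<open>d z\<^sub>k = a\<^sub>k y\<^sub>0\<close> compatible with the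
  relations \<open>a\<^sub>k = c\<^sub>k a\<^sub>k\<^sub>+\<^sub>1\<close>, so \<open>a\<^sub>k \<mapsto> z\<^sub>k\<close> is linear on \<open>J\<close>, hence of the form \<open>r \<mapsto> r e\<close> by injectivity.
  Then \<open>y\<^sub>0 - d e\<close> is killed by \<open>J\<close> and maps to \<open>x\<close>.\<close>

section \<open>Linear maps on ascending unions of principal ideals\<close>

lemma injective_module_chain:
  fixes R :: "('a, 'b) ring_scheme" (structure) and E :: "('a, 'e) module"
  assumes "domain R" and E: "injective_module R E"
    and a: "\<And>k. a k \<in> carrier R - {\<zero>}" and z: "\<And>k. z k \<in> carrier E"
    and chain: "\<And>k::nat. \<exists>c\<in>carrier R. a k = c \<otimes> a (Suc k) \<and> z k = c \<odot>\<^bsub>E\<^esub> z (Suc k)"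
  shows "\<exists>e\<in>carrier E. \<forall>k. z k = a k \<odot>\<^bsub>E\<^esub> e"
proof -
  interpret "domain" R by fact
  have "Module.module R E" using E by (simp add: injective_module_def)
  then interpret E: Module.module R E .
  have ac [simp]: "a k \<in> carrier R" "a k \<noteq> \<zero>" and zc [simp]: "z k \<in> carrier E" for k
    using a z by auto
  have le: "\<exists>r\<in>carrier R. a k = r \<otimes> a l \<and> z k = r \<odot>\<^bsub>E\<^esub> z l" if "k \<le> l" for k l
    using that
  proof (induction l rule: dec_induct)
    case base
    show ?case by (intro bexI[of _ \<one>]) auto
  next
    case (step l)
    then obtain r where r: "r \<in> carrier R" "a k = r \<otimes> a l" "z k = r \<odot>\<^bsub>E\<^esub> z l" by blast
    obtain c where c: "c \<in> carrier R" "a l = c \<otimes> a (Suc l)" "z l = c \<odot>\<^bsub>E\<^esub> z (Suc l)"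
      using chain by blast
    show ?case
      using r c by (intro bexI[of _ "r \<otimes> c"]) (auto simp: m_assoc E.smult_assoc1)
  qed
  \<comment> \<open>\<open>F\<close> is the graph of this map; pairs postpone the proof that the
    value depends on \<open>r \<otimes> a k\<close> alone.\<close>
  define F where "F = (\<lambda>(r, k). (r \<otimes> a k, r \<odot>\<^bsub>E\<^esub> z k)) ` (carrier R \<times> UNIV)"
  have FI: "(r \<otimes> a k, r \<odot>\<^bsub>E\<^esub> z k) \<in> F" if "r \<in> carrier R" for r k
    using that by (auto simp: F_def)
  have Fc: "x \<in> carrier R" "w \<in> carrier E" if "(x, w) \<in> F" for x w
    using that by (auto simp: F_def)
  have raise: "\<exists>r\<in>carrier R. x = r \<otimes> a l \<and> w = r \<odot>\<^bsub>E\<^esub> z l"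
    if "s \<in> carrier R" "x = s \<otimes> a k" "w = s \<odot>\<^bsub>E\<^esub> z k" "k \<le> l" for x w s k l
  proof -
    obtain r where "r \<in> carrier R" "a k = r \<otimes> a l" "z k = r \<odot>\<^bsub>E\<^esub> z l"
      using le \<open>k \<le> l\<close> by blast
    then show ?thesis
      using that by (intro bexI[of _ "s \<otimes> r"]) (auto simp: m_assoc E.smult_assoc1)
  qed
  \<comment> \<open>Two elements can be written over the larger of their indices, so that uniqueness
    and additivity concern coefficients of one and the same \<open>a k\<close>.\<close>
  have common: "\<exists>k. \<exists>r\<in>carrier R. \<exists>s\<in>carrier R. x = r \<otimes> a k \<and> w = r \<odot>\<^bsub>E\<^esub> z k \<and>
      y = s \<otimes> a k \<and> v = s \<odot>\<^bsub>E\<^esub> z k" if "(x, w) \<in> F" "(y, v) \<in> F" for x w y v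
  proof -
    obtain r k s l where "r \<in> carrier R" "x = r \<otimes> a k" "w = r \<odot>\<^bsub>E\<^esub> z k"
        "s \<in> carrier R" "y = s \<otimes> a l" "v = s \<odot>\<^bsub>E\<^esub> z l"
      using \<open>(x, w) \<in> F\<close> \<open>(y, v) \<in> F\<close> unfolding F_def by auto
    then show ?thesis
      using raise[of r x k w "max k l"] raise[of s y l v "max k l"] by (meson max.cobounded1 max.cobounded2)
  qed
  have unique: "w = v" if xw: "(x, w) \<in> F" "(x, v) \<in> F" for x w v
  proof -
    obtain k r s where rs: "r \<in> carrier R" "s \<in> carrier R" "x = r \<otimes> a k" "w = r \<odot>\<^bsub>E\<^esub> z k"
        "x = s \<otimes> a k" "v = s \<odot>\<^bsub>E\<^esub> z k"
      using common[OF xw] by blast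
    then have "r = s" using m_rcancel[of "a k" r s] by simp
    then show ?thesis using rs by simp
  qed
  have add: "(x \<oplus> y, w \<oplus>\<^bsub>E\<^esub> v) \<in> F" if xw: "(x, w) \<in> F" "(y, v) \<in> F" for x w y v
  proof -
    obtain k r s where rs: "r \<in> carrier R" "s \<in> carrier R" "x = r \<otimes> a k" "w = r \<odot>\<^bsub>E\<^esub> z k"
        "y = s \<otimes> a k" "v = s \<odot>\<^bsub>E\<^esub> z k"
      using common[OF xw] by blast
    then show ?thesis
      using FI[of "r \<oplus> s" k] by (simp add: l_distr E.smult_l_distr)
  qed
  have smult: "(c \<otimes> x, c \<odot>\<^bsub>E\<^esub> w) \<in> F" if c: "c \<in> carrier R" and xw: "(x, w) \<in> F" for c x w
  proof -
    obtain r k where "r \<in> carrier R" "x = r \<otimes> a k" "w = r \<odot>\<^bsub>E\<^esub> z k"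
      using xw unfolding F_def by auto
    then show ?thesis
      using FI[of "c \<otimes> r" k] c by (simp add: m_assoc E.smult_assoc1)
  qed
  define J where "J = fst ` F"
  define \<phi> where "\<phi> x = (THE w. (x, w) \<in> F)" for x
  have \<phi>: "\<phi> x = w" if "(x, w) \<in> F" for x w
    unfolding \<phi>_def using that unique by blast
  have \<phi>F: "(x, \<phi> x) \<in> F" if "x \<in> J" for x
    using that \<phi> by (auto simp: J_def)
  have JI: "x \<in> J" if "(x, w) \<in> F" for x w
    using that by (force simp: J_def)
  have "ideal J R"
  proof (rule idealI)
    show "subgroup J (add_monoid R)"
    proof (rule add.subgroupI)
      show "J \<subseteq> carrier R" using Fc \<phi>F by blast
      show "J \<noteq> {}" using JI[OF FI[of \<one>]] by blast
      show "x \<oplus> y \<in> J" if "x \<in> J" "y \<in> J" for x y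
        using add \<phi>F JI that by blast
      show "\<ominus> x \<in> J" if "x \<in> J" for x
      proof -
        have "(\<ominus> \<one>) \<otimes> x = \<ominus> x" using Fc(1)[OF \<phi>F[OF that]] by (simp add: l_minus)
        then show ?thesis using smult[OF _ \<phi>F[OF that], of "\<ominus> \<one>"] JI by auto
      qed
    qed
    show "c \<otimes> x \<in> J" if "x \<in> J" "c \<in> carrier R" for c x
      using smult \<phi>F JI that by blast
    then show "x \<otimes> c \<in> J" if "x \<in> J" "c \<in> carrier R" for c x
      using that Fc(1)[OF \<phi>F] by (metis m_comm)
  qed (rule ring_axioms)
  then have "\<exists>e\<in>carrier E. \<forall>x\<in>J. \<phi> x = x \<odot>\<^bsub>E\<^esub> e"
  proof (rule injective_module_ideal_extend[OF E])
    show "\<phi> \<in> J \<rightarrow> carrier E" using Fc(2) \<phi>F by blast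
    show "\<phi> (x \<oplus> y) = \<phi> x \<oplus>\<^bsub>E\<^esub> \<phi> y" if "x \<in> J" "y \<in> J" for x y
      by (rule \<phi>[OF add[OF \<phi>F[OF that(1)] \<phi>F[OF that(2)]]])
    show "\<phi> (c \<otimes> x) = c \<odot>\<^bsub>E\<^esub> \<phi> x" if "c \<in> carrier R" "x \<in> J" for c x
      by (rule \<phi>[OF smult[OF that(1) \<phi>F[OF that(2)]]])
  qed
  then obtain e where e: "e \<in> carrier E" "\<And>x. x \<in> J \<Longrightarrow> \<phi> x = x \<odot>\<^bsub>E\<^esub> e" by blast
  have "z k = a k \<odot>\<^bsub>E\<^esub> e" for k
    using e(2)[OF JI[OF FI[of \<one> k]]] \<phi>[OF FI[of \<one> k]] by simp
  then show ?thesis using e(1) by blast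
qed

text \<open>A constant sequence is a chain with linking factor one.\<close>

lemma injective_module_divisible:
  assumes "domain R" "injective_module R E" "c \<in> carrier R - {\<zero>\<^bsub>R\<^esub>}" "w \<in> carrier E"
  shows "\<exists>u\<in>carrier E. w = c \<odot>\<^bsub>E\<^esub> u"
proof -
  interpret "domain" R by fact
  interpret E: Module.module R E using assms(2) by (simp add: injective_module_def)
  show ?thesis
    using injective_module_chain[of R E "\<lambda>_. c" "\<lambda>_. w"] assms
    by (metis DiffD1 E.smult_one l_one one_closed)
qed

section \<open>Cocycles killed by a divisor chain\<close>

lemma linear_mapsD:
  assumes "f \<in> linear_maps R M N"
  shows "x \<in> carrier M \<Longrightarrow> f x \<in> carrier N"
    and "\<lbrakk>x \<in> carrier M; y \<in> carrier M\<rbrakk> \<Longrightarrow> f (x \<oplus>\<^bsub>M\<^esub> y) = f x \<oplus>\<^bsub>N\<^esub> f y"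
    and "\<lbrakk>a \<in> carrier R; x \<in> carrier M\<rbrakk> \<Longrightarrow> f (a \<odot>\<^bsub>M\<^esub> x) = a \<odot>\<^bsub>N\<^esub> f x"
  using assms by (auto simp: linear_maps_def)

lemma linear_maps_minus:
  assumes "Module.module R M" "Module.module R N" and f: "f \<in> linear_maps R M N"
    and "x \<in> carrier M" "y \<in> carrier M"
  shows "f (x \<ominus>\<^bsub>M\<^esub> y) = f x \<ominus>\<^bsub>N\<^esub> f y"
proof -
  interpret M: Module.module R M by fact
  interpret N: Module.module R N by fact
  have "f (x \<ominus>\<^bsub>M\<^esub> y) \<oplus>\<^bsub>N\<^esub> f y = f ((x \<ominus>\<^bsub>M\<^esub> y) \<oplus>\<^bsub>M\<^esub> y)"
    using assms by (simp add: linear_mapsD(2)[OF f])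
  also have "(x \<ominus>\<^bsub>M\<^esub> y) \<oplus>\<^bsub>M\<^esub> y = x"
    using assms by (simp add: M.minus_eq M.a_assoc M.l_neg)
  finally show ?thesis
    using assms linear_mapsD(1)[OF f]
    by (metis M.minus_closed N.M.add.inv_solve_right' N.minus_eq)
qed

text \<open>Two degrees below \<open>y0\<close> are used: \<open>E (Suc p)\<close> holds lifts of
  the multiples \<open>a k\<close> times \<open>y0\<close>, and \<open>E p\<close> holds the
  corrections that make successive lifts compatible. Thus \<open>y0\<close> has degree
  \<open>p + 2\<close> and its image degree \<open>p + 3\<close>, which is the source of the bound
  3.\<close>

lemma cocycle_lift:
  fixes R :: "('a, 'b) ring_scheme" (structure) and E :: "nat \<Rightarrow> ('a, 'e) module"
  assumes "domain R" and inj: "\<And>n. injective_module R (E n)"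
    and d: "\<And>n. d n \<in> linear_maps R (E n) (E (Suc n))"
    and exact: "\<And>n. d n ` carrier (E n) = linear_kernel (E (Suc n)) (E (Suc (Suc n))) (d (Suc n))"
    and a: "\<And>k::nat. a k \<in> carrier R - {\<zero>}" and div: "\<And>k. a (Suc k) divides a k"
    and y0: "y0 \<in> carrier (E (Suc (Suc p)))"
    and kill: "\<And>k. a k \<odot>\<^bsub>E (Suc (Suc (Suc p)))\<^esub> d (Suc (Suc p)) y0 = \<zero>\<^bsub>E (Suc (Suc (Suc p)))\<^esub>"
  shows "\<exists>y\<in>carrier (E (Suc (Suc p))). d (Suc (Suc p)) y = d (Suc (Suc p)) y0 \<and>
    (\<forall>k. a k \<odot>\<^bsub>E (Suc (Suc p))\<^esub> y = \<zero>\<^bsub>E (Suc (Suc p))\<^esub>)"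
proof -
  interpret "domain" R by fact
  have mE: "Module.module R (E n)" for n using inj by (simp add: injective_module_def)
  define q where "q = Suc p"
  define r where "r = Suc q"
  interpret P: Module.module R "E p" by (rule mE)
  interpret Q: Module.module R "E q" by (rule mE)
  interpret S: Module.module R "E r" by (rule mE)
  interpret T: Module.module R "E (Suc r)" by (rule mE)
  have ac [simp]: "a k \<in> carrier R" "a k \<noteq> \<zero>" for k using a by auto
  have y0 [simp]: "y0 \<in> carrier (E r)" using y0 by (simp add: r_def q_def)
  note dp = d[of p, folded q_def] and dq = d[of q, folded r_def] and dr = d[of r]
  have exq: "d p ` carrier (E p) = linear_kernel (E q) (E r) (d q)"
    using exact[of p] by (simp add: r_def q_def)
  have exr: "d q ` carrier (E q) = linear_kernel (E r) (E (Suc r)) (d r)"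
    using exact[of q] by (simp add: r_def q_def)
  note [simp] = linear_mapsD(1)[OF dp] linear_mapsD(1)[OF dq] linear_mapsD(1)[OF dr]
  have lift: "\<exists>z\<in>carrier (E q). d q z = a k \<odot>\<^bsub>E r\<^esub> y0" for k
  proof -
    have "d r (a k \<odot>\<^bsub>E r\<^esub> y0) = \<zero>\<^bsub>E (Suc r)\<^esub>"
      using kill[of k] by (simp add: linear_mapsD(3)[OF dr]) (simp add: r_def q_def)
    then have "a k \<odot>\<^bsub>E r\<^esub> y0 \<in> d q ` carrier (E q)"
      unfolding exr by (simp add: linear_kernel_def)
    then show ?thesis by auto
  qed
  have step: "\<exists>z'. (z' \<in> carrier (E q) \<and> d q z' = a (Suc k) \<odot>\<^bsub>E r\<^esub> y0) \<and>
      (\<exists>c\<in>carrier R. a k = c \<otimes> a (Suc k) \<and> z = c \<odot>\<^bsub>E q\<^esub> z')"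
    if z: "z \<in> carrier (E q) \<and> d q z = a k \<odot>\<^bsub>E r\<^esub> y0" for z k
  proof -
    obtain c where c: "c \<in> carrier R" "a k = c \<otimes> a (Suc k)"
      using div[of k] by (metis dividesE m_comm ac(1))
    then have c0: "c \<noteq> \<zero>" using ac(2)[of k] by auto
    \<comment> \<open>An arbitrary lift \<open>z1\<close> satisfies \<open>z = c z1\<close> only up
      to a coboundary \<open>d p w\<close>. As \<open>E p\<close> is divisible, \<open>w\<close> is
      \<open>c\<close> times some \<open>u\<close>, and adding \<open>d p u\<close> to
      \<open>z1\<close> removes the defect without changing \<open>d q z1\<close>.\<close>
    obtain z1 where z1: "z1 \<in> carrier (E q)" "d q z1 = a (Suc k) \<odot>\<^bsub>E r\<^esub> y0" using lift by blast
    have "d q (z \<ominus>\<^bsub>E q\<^esub> c \<odot>\<^bsub>E q\<^esub> z1) = d q z \<ominus>\<^bsub>E r\<^esub> c \<odot>\<^bsub>E r\<^esub> d q z1"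
      using z z1 c by (simp add: linear_maps_minus[OF mE mE dq] linear_mapsD(3)[OF dq])
    also have "\<dots> = \<zero>\<^bsub>E r\<^esub>"
      using z z1 c by (simp add: S.smult_assoc1 S.minus_eq S.r_neg)
    finally have "z \<ominus>\<^bsub>E q\<^esub> c \<odot>\<^bsub>E q\<^esub> z1 \<in> d p ` carrier (E p)"
      unfolding exq using z z1 c by (simp add: linear_kernel_def)
    then obtain w where w: "w \<in> carrier (E p)" "z \<ominus>\<^bsub>E q\<^esub> c \<odot>\<^bsub>E q\<^esub> z1 = d p w" by auto
    obtain u where u: "u \<in> carrier (E p)" "w = c \<odot>\<^bsub>E p\<^esub> u"
      using injective_module_divisible[OF \<open>domain R\<close> inj[of p], of c w] c c0 w by auto
    have "d p u \<in> linear_kernel (E q) (E r) (d q)" using u exq by blast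
    then have du: "d q (d p u) = \<zero>\<^bsub>E r\<^esub>" by (simp add: linear_kernel_def)
    define z' where "z' = z1 \<oplus>\<^bsub>E q\<^esub> d p u"
    have "z = (z \<ominus>\<^bsub>E q\<^esub> c \<odot>\<^bsub>E q\<^esub> z1) \<oplus>\<^bsub>E q\<^esub> c \<odot>\<^bsub>E q\<^esub> z1"
      using z z1 c by (simp add: Q.minus_eq Q.a_assoc Q.l_neg)
    also have "\<dots> = c \<odot>\<^bsub>E q\<^esub> z'"
      using w(2) u z1 c
      by (simp add: z'_def linear_mapsD(3)[OF dp] Q.smult_r_distr Q.a_comm)
    finally have "z = c \<odot>\<^bsub>E q\<^esub> z'" .
    moreover have "d q z' = a (Suc k) \<odot>\<^bsub>E r\<^esub> y0" "z' \<in> carrier (E q)"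
      using z1 u du by (simp_all add: z'_def linear_mapsD(2)[OF dq])
    ultimately show ?thesis using c by blast
  qed
  have "\<exists>z. \<forall>k. (z k \<in> carrier (E q) \<and> d q (z k) = a k \<odot>\<^bsub>E r\<^esub> y0) \<and>
      (\<exists>c\<in>carrier R. a k = c \<otimes> a (Suc k) \<and> z k = c \<odot>\<^bsub>E q\<^esub> z (Suc k))"
  proof (rule dependent_nat_choice)
    show "\<exists>z. z \<in> carrier (E q) \<and> d q z = a 0 \<odot>\<^bsub>E r\<^esub> y0" using lift[of 0] by blast
  qed (rule step)
  then obtain z where z: "\<And>k. z k \<in> carrier (E q)" "\<And>k. d q (z k) = a k \<odot>\<^bsub>E r\<^esub> y0"
    "\<And>k. \<exists>c\<in>carrier R. a k = c \<otimes> a (Suc k) \<and> z k = c \<odot>\<^bsub>E q\<^esub> z (Suc k)"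
    by metis
  \<comment> \<open>Now \<open>a k\<close> times \<open>d q e\<close> equals
    \<open>d q (z k)\<close>, that is, \<open>a k\<close> times \<open>y0\<close>. Subtracting
    \<open>d q e\<close> from \<open>y0\<close> makes every \<open>a k\<close> kill it and leaves
    its image under \<open>d r\<close> unchanged.\<close>
  obtain e where e: "e \<in> carrier (E q)" "\<And>k. z k = a k \<odot>\<^bsub>E q\<^esub> e"
    using injective_module_chain[OF \<open>domain R\<close> inj[of q], of a z] a z(1,3) by blast
  have "d q e \<in> linear_kernel (E r) (E (Suc r)) (d r)" using e exr by blast
  then have de: "d r (d q e) = \<zero>\<^bsub>E (Suc r)\<^esub>" by (simp add: linear_kernel_def)
  have "d r (y0 \<ominus>\<^bsub>E r\<^esub> d q e) = d r y0"
    using e de by (simp add: linear_maps_minus[OF mE mE dr] T.minus_eq)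
  moreover have "a k \<odot>\<^bsub>E r\<^esub> (y0 \<ominus>\<^bsub>E r\<^esub> d q e) = \<zero>\<^bsub>E r\<^esub>" for k
  proof -
    have "a k \<odot>\<^bsub>E r\<^esub> d q e = a k \<odot>\<^bsub>E r\<^esub> y0"
      using z(2)[of k] e linear_mapsD(3)[OF dq, of "a k" e] by simp
    then show ?thesis
      using e by (simp add: S.minus_eq S.smult_r_distr S.smult_r_minus S.r_neg)
  qed
  moreover have "y0 \<ominus>\<^bsub>E r\<^esub> d q e \<in> carrier (E r)" using e by simp
  ultimately have "\<exists>y\<in>carrier (E r). d r y = d r y0 \<and> (\<forall>k. a k \<odot>\<^bsub>E r\<^esub> y = \<zero>\<^bsub>E r\<^esub>)"
    by blast
  then show ?thesis by (simp only: r_def q_def)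
qed

section \<open>Prime ideals in finite Krull dimension\<close>

text \<open>The dimension is a supremum of chain lengths, so a chain with one step more than its
  value cannot exist.\<close>

lemma finite_dim_no_prime_chain:
  assumes "krull_dim R < \<infinity>"
  obtains n where "\<And>P. \<lbrakk>\<forall>k\<le>n. primeideal (P k) R; \<forall>k<n. P k \<subset> P (Suc k)\<rbrakk> \<Longrightarrow> False"
proof -
  obtain m where m: "krull_dim R = enat m" using assms by (cases "krull_dim R") auto
  have "False" if "\<forall>k\<le>Suc m. primeideal (P k) R" "\<forall>k<Suc m. P k \<subset> P (Suc k)" for P
  proof -
    have "enat (Suc m) \<le> krull_dim R"
      unfolding krull_dim_def using that by (intro Sup_upper) blast
    then show False using m by simp
  qed
  then show thesis using that by blast
qed

lemma wf_prime_psubset: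
  assumes "krull_dim R < \<infinity>"
  shows "wf {(P, Q). primeideal P R \<and> primeideal Q R \<and> P \<subset> Q}"
    and "wf {(Q, P). primeideal P R \<and> primeideal Q R \<and> P \<subset> Q}"
proof -
  obtain n where n: "\<And>P. \<lbrakk>\<forall>k\<le>n. primeideal (P k) R; \<forall>k<n. P k \<subset> P (Suc k)\<rbrakk> \<Longrightarrow> False"
    using finite_dim_no_prime_chain[OF assms] by blast
  show "wf {(P, Q). primeideal P R \<and> primeideal Q R \<and> P \<subset> Q}"
    unfolding wf_iff_no_infinite_down_chain
  proof (rule notI, elim exE)
    fix f assume f: "\<forall>i. (f (Suc i), f i) \<in> {(P, Q). primeideal P R \<and> primeideal Q R \<and> P \<subset> Q}"
    \<comment> \<open>The first \<open>n + 1\<close> terms read backwards form an ascending chain of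
      \<open>n\<close> steps.\<close>
    have "f (n - k) \<subset> f (n - Suc k)" if "k < n" for k
      using f[rule_format, of "n - Suc k"] that by (simp add: Suc_diff_Suc)
    then show False using n[of "\<lambda>k. f (n - k)"] f by blast
  qed
  show "wf {(Q, P). primeideal P R \<and> primeideal Q R \<and> P \<subset> Q}"
    unfolding wf_iff_no_infinite_down_chain
    using n by blast
qed

lemma exists_minimal_prime:
  assumes "krull_dim R < \<infinity>" "primeideal N R" "\<Phi> N"
  shows "\<exists>Q. primeideal Q R \<and> \<Phi> Q \<and> (\<forall>P. primeideal P R \<longrightarrow> P \<subset> Q \<longrightarrow> \<not> \<Phi> P)"
  using wf_eq_minimal[THEN iffD1, OF wf_prime_psubset(1)[OF assms(1)], rule_format,
      of N "{P. primeideal P R \<and> \<Phi> P}"] assms(2,3) by auto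

lemma exists_maximal_prime:
  assumes "krull_dim R < \<infinity>" "primeideal N R" "\<Phi> N"
  shows "\<exists>P. primeideal P R \<and> \<Phi> P \<and> (\<forall>Q. primeideal Q R \<longrightarrow> P \<subset> Q \<longrightarrow> \<not> \<Phi> Q)"
  using wf_eq_minimal[THEN iffD1, OF wf_prime_psubset(2)[OF assms(1)], rule_format,
      of N "{P. primeideal P R \<and> \<Phi> P}"] assms(2,3) by auto

section \<open>Divisibility and primes in a valuation ring\<close>

context valuation_ring
begin

lemma pow_nonzero: "\<lbrakk>x \<in> carrier R; x \<noteq> \<zero>\<rbrakk> \<Longrightarrow> x [^] (n::nat) \<noteq> \<zero>"
  by (induction n) (auto simp: integral_iff)

lemma ideal_divides_closed:
  assumes "ideal J R" "x \<in> J" "x divides y"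
  shows "y \<in> J"
  using assms ideal.I_r_closed[OF assms(1)] by (auto elim!: dividesE)

lemma ideals_linear:
  assumes "ideal J R" "ideal K R"
  shows "J \<subseteq> K \<or> K \<subseteq> J"
proof (rule ccontr)
  assume "\<not> ?thesis"
  then obtain x y where xy: "x \<in> J" "x \<notin> K" "y \<in> K" "y \<notin> J" by blast
  then have "x \<in> carrier R" "y \<in> carrier R" using ideal.Icarr assms by metis+
  then show False using divides_total xy ideal_divides_closed assms by blast
qed

lemma pow_divides_pow:
  assumes "x \<in> carrier R" "y \<in> carrier R" "x divides y"
  shows "x [^] (n::nat) divides y [^] n"
proof -
  obtain c where "c \<in> carrier R" "y = x \<otimes> c" using assms by blast
  then show ?thesis using assms by (intro dividesI[of "c [^] n"]) (simp_all add: nat_pow_distrib)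
qed

text \<open>If \<open>x = y \<otimes> c\<close>, cancelling \<open>y [^] n\<close> shows that
  \<open>c [^] n\<close>, and hence \<open>c\<close>, is a unit. In the value group: n v(x) \<le> n
  v(y) implies v(x) \<le> v(y) for positive n.\<close>

lemma divides_if_pow_divides:
  assumes x: "x \<in> carrier R" and y: "y \<in> carrier R" and "0 < n" and xy: "x [^] (n::nat) divides y [^] n"
  shows "x divides y"
proof (cases "y = \<zero> \<or> x divides y")
  case False
  then obtain c where c: "c \<in> carrier R" "x = y \<otimes> c" using divides_total[OF x y] by blast
  have "y [^] n \<otimes> c [^] n divides y [^] n \<otimes> \<one>"
    using xy c y by (simp add: nat_pow_distrib)
  then obtain e where e: "e \<in> carrier R" "y [^] n \<otimes> \<one> = y [^] n \<otimes> c [^] n \<otimes> e" by blast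
  then have "y [^] n \<otimes> \<one> = y [^] n \<otimes> (c [^] n \<otimes> e)" using y c by (simp add: m_assoc)
  then have "c [^] n \<otimes> e = \<one>"
    using m_lcancel[of "y [^] n" \<one> "c [^] n \<otimes> e"] pow_nonzero[OF y, of n] False y c e by simp
  moreover obtain m where "n = Suc m" using \<open>0 < n\<close> gr0_implies_Suc by blast
  ultimately have "c \<otimes> (c [^] m \<otimes> e) = \<one>" using c e by (simp add: m_ac)
  then have "x \<otimes> (c [^] m \<otimes> e) = y" using c e y by (simp add: m_assoc)
  then show ?thesis using c e y by (metis dividesI m_closed nat_pow_closed)
qed (use x in \<open>auto intro: dividesI[of \<zero>]\<close>)

text \<open>If \<open>x\<close> and \<open>y\<close> lie outside, they divide powers
  \<open>c [^] n\<close> and \<open>c [^] m\<close>, so \<open>x \<otimes> y\<close> divides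
  \<open>c [^] (n + m)\<close>. Were it also divisible by the next power, \<open>c\<close> would be
  a unit.\<close>

lemma primeideal_Inter_powers:
  assumes c: "c \<in> carrier R" "c \<noteq> \<zero>" "\<not> c divides \<one>"
  shows "primeideal {x \<in> carrier R. \<forall>n::nat. c [^] n divides x} R" (is "primeideal ?P R")
proof (rule primeidealI)
  have cn [simp]: "c [^] n \<in> carrier R" "c [^] n \<noteq> \<zero>" for n :: nat
    using c pow_nonzero by auto
  show "ideal ?P R"
  proof (rule idealI)
    show "subgroup ?P (add_monoid R)"
    proof (rule add.subgroupI)
      show "?P \<noteq> {}" by (auto intro!: exI[of _ \<zero>] dividesI[of \<zero>])
      show "\<ominus> x \<in> ?P" if "x \<in> ?P" for x
      proof -
        have "c [^] n divides \<ominus> x" for n :: nat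
        proof -
          have "c [^] n divides x" using that by simp
          then obtain e where "e \<in> carrier R" "x = c [^] n \<otimes> e" by (rule dividesE)
          then show ?thesis by (intro dividesI[of "\<ominus> e"]) (simp_all add: r_minus)
        qed
        then show ?thesis using that by simp
      qed
      show "x \<oplus> y \<in> ?P" if "x \<in> ?P" "y \<in> ?P" for x y
      proof -
        have "c [^] n divides (x \<oplus> y)" for n :: nat
        proof -
          have "c [^] n divides x" "c [^] n divides y" using that by simp_all
          then obtain e f where "e \<in> carrier R" "x = c [^] n \<otimes> e" "f \<in> carrier R" "y = c [^] n \<otimes> f"
            by (elim dividesE)
          then show ?thesis by (intro dividesI[of "e \<oplus> f"]) (simp_all add: r_distr)
        qed
        then show ?thesis using that by simp
      qed
    qed auto
    show "x \<otimes> a \<in> ?P" if "a \<in> ?P" "x \<in> carrier R" for a x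
      using that by (auto intro: divides_prod_l)
    show "a \<otimes> x \<in> ?P" if "a \<in> ?P" "x \<in> carrier R" for a x
      using that by (auto intro: divides_prod_r)
  qed (rule ring_axioms)
  have "\<one> \<notin> ?P" using c by (auto intro!: exI[of _ 1])
  then show "carrier R \<noteq> ?P" by blast
  show "x \<in> ?P \<or> y \<in> ?P" if xy: "x \<in> carrier R" "y \<in> carrier R" "x \<otimes> y \<in> ?P" for x y
  proof (rule ccontr)
    assume "\<not> ?thesis"
    then obtain n m :: nat where "\<not> c [^] n divides x" "\<not> c [^] m divides y" using xy by auto
    then have "x divides c [^] n" "y divides c [^] m" using divides_total xy cn by blast+
    then obtain e f where ef: "e \<in> carrier R" "c [^] n = x \<otimes> e" "f \<in> carrier R" "c [^] m = y \<otimes> f"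
      by (elim dividesE)
    have "c [^] k divides x \<otimes> y" for k :: nat using xy(3) by simp
    then have "c [^] Suc (n + m) divides (x \<otimes> y) \<otimes> (e \<otimes> f)"
      by (rule divides_prod_r[OF _ cn(1) m_closed[OF ef(1,3)]])
    moreover have "(x \<otimes> y) \<otimes> (e \<otimes> f) = c [^] (n + m)"
      using xy ef by (simp add: nat_pow_mult[symmetric] c m_ac)
    ultimately have "c [^] (n + m) \<otimes> c divides c [^] (n + m) \<otimes> \<one>" by simp
    then obtain g where g: "g \<in> carrier R" "c [^] (n + m) \<otimes> \<one> = c [^] (n + m) \<otimes> c \<otimes> g" by blast
    then have "c [^] (n + m) \<otimes> \<one> = c [^] (n + m) \<otimes> (c \<otimes> g)" using c by (simp add: m_assoc)
    then have "\<one> = c \<otimes> g" using m_lcancel[of "c [^] (n + m)" \<one> "c \<otimes> g"] g c cn by simp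
    then show False using c g by blast
  qed
qed (rule is_cring)

text \<open>This is the archimedean property between neighbouring primes: each ring element outside
  \<open>P\<close> divides some power of \<open>c\<close>. The intersection of the powers is a prime
  inside \<open>Q\<close> that misses \<open>c\<close>, so \<open>cover\<close> forbids it to
  contain \<open>P\<close> properly; ideals being comparable, it lies in \<open>P\<close>.\<close>

lemma Inter_powers_subset_prime:
  assumes P: "primeideal P R" and Q: "primeideal Q R"
    and cover: "\<And>P'. \<lbrakk>primeideal P' R; P \<subset> P'\<rbrakk> \<Longrightarrow> \<not> P' \<subset> Q"
    and c: "c \<in> Q" "c \<notin> P"
  shows "{x \<in> carrier R. \<forall>n::nat. c [^] n divides x} \<subseteq> P" (is "?P \<subseteq> P")
proof -
  interpret P: primeideal P R by fact
  interpret Q: primeideal Q R by fact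
  have cR: "c \<in> carrier R" using c Q.Icarr by blast
  have c0: "c \<noteq> \<zero>" using c P.zero_closed by blast
  have c1: "\<not> c divides \<one>"
    using ideal_divides_closed[OF Q.ideal_axioms c(1)] Q.one_imp_carrier Q.I_notcarr by blast
  have prime: "primeideal ?P R" using primeideal_Inter_powers[OF cR c0 c1] .
  have id: "ideal ?P R" using prime primeideal_def by blast
  have "c \<notin> ?P"
  proof
    assume "c \<in> ?P"
    then have "c [^] (2::nat) divides c" by simp
    then obtain e where e: "e \<in> carrier R" "c = c \<otimes> c \<otimes> e"
      using cR by (auto simp: numeral_2_eq_2)
    then have "c \<otimes> \<one> = c \<otimes> (c \<otimes> e)" using cR by (simp add: m_assoc)
    then have "\<one> = c \<otimes> e" using m_lcancel[of c \<one> "c \<otimes> e"] cR c0 e by simp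
    then show False using c1 e by blast
  qed
  then have "?P \<subset> Q" using ideals_linear[OF id Q.ideal_axioms] c(1) by blast
  then have "\<not> P \<subset> ?P" using cover[OF prime] by blast
  then show ?thesis using ideals_linear[OF id P.ideal_axioms] by blast
qed

text \<open>Of two nonunits one divides the other, so their sum is a multiple of a nonunit. This
  prime is the starting point when a minimal prime above a given one is selected.\<close>

lemma primeideal_nonunits: "primeideal {x \<in> carrier R. \<not> x divides \<one>} R" (is "primeideal ?N R")
proof (rule primeidealI)
  have mult: "\<not> x \<otimes> y divides \<one>" if "x \<in> carrier R" "y \<in> carrier R" "\<not> x divides \<one>" for x y
    using that by (meson divides_trans dividesI m_closed)
  show "ideal ?N R"
  proof (rule idealI)
    show "subgroup ?N (add_monoid R)"
    proof (rule add.subgroupI)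
      have "\<not> \<zero> divides \<one>" by (auto elim!: dividesE)
      then show "?N \<noteq> {}" by blast
      show "\<ominus> x \<in> ?N" if "x \<in> ?N" for x
      proof -
        have "\<ominus> x = x \<otimes> \<ominus> \<one>" using that by (simp add: r_minus)
        then show ?thesis using mult[of x "\<ominus> \<one>"] that by simp
      qed
      show "x \<oplus> y \<in> ?N" if xy: "x \<in> ?N" "y \<in> ?N" for x y
      proof -
        have *: "\<not> (u \<oplus> v) divides \<one>" if "u \<in> ?N" "v \<in> ?N" "u divides v" for u v
        proof -
          obtain e where e: "e \<in> carrier R" "v = u \<otimes> e" using \<open>u divides v\<close> by (rule dividesE)
          then have "u \<oplus> v = u \<otimes> (\<one> \<oplus> e)" using that by (simp add: r_distr)
          then show ?thesis using mult[of u "\<one> \<oplus> e"] that e by simp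
        qed
        show ?thesis
          using divides_total[of x y] *[of x y] *[of y x] xy by (auto simp: a_comm)
      qed
    qed auto
    show "x \<otimes> a \<in> ?N" if "a \<in> ?N" "x \<in> carrier R" for a x
      using that mult[of a x] by (auto simp: m_comm)
    show "a \<otimes> x \<in> ?N" if "a \<in> ?N" "x \<in> carrier R" for a x
      using that mult[of a x] by auto
  qed (rule ring_axioms)
  have "\<one> divides \<one>" by simp
  then show "carrier R \<noteq> ?N" by blast
  show "x \<in> ?N \<or> y \<in> ?N" if xy: "x \<in> carrier R" "y \<in> carrier R" "x \<otimes> y \<in> ?N" for x y
  proof (rule ccontr)
    assume "\<not> ?thesis"
    then have "x divides \<one>" "y divides \<one>" using xy by auto
    then have "x \<otimes> y divides x \<otimes> \<one>" "x \<otimes> \<one> divides \<one>"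
      using xy by (auto simp del: r_one intro: divides_mult_lI) (simp add: r_one)
    then have "x \<otimes> y divides \<one>" using xy by (meson divides_trans m_closed one_closed)
    then show False using xy by simp
  qed
qed (rule is_cring)

lemma primeideal_pow_notin:
  assumes "primeideal P R" "s \<in> carrier R" "s \<notin> P"
  shows "s [^] (n::nat) \<notin> P"
proof (induction n)
  interpret P: primeideal P R by fact
  case 0
  show ?case using P.one_imp_carrier P.I_notcarr by auto
next
  interpret P: primeideal P R by fact
  case (Suc n)
  then show ?case using P.I_prime[of "s [^] n" s] assms by auto
qed

section \<open>Countable generation of ideals\<close>

lemma ideal_countably_generated:
  assumes dim: "krull_dim R < \<infinity>" and J: "ideal J R" "J \<noteq> {\<zero>}"
  shows "\<exists>g :: nat \<Rightarrow> nat \<Rightarrow> 'a. (\<forall>m n. g m n \<in> J - {\<zero>}) \<and> (\<forall>j\<in>J. \<exists>m n. g m n divides j)"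
proof -
  interpret J: ideal J R by (rule J(1))
  \<comment> \<open>\<open>K P\<close>: for some nonzero \<open>a \<in> J\<close> no quotient \<open>a/b \<in> V\<close> with \<open>b \<in> J\<close> lies in \<open>P\<close>. If \<open>P\<close> is maximal
    with this property and \<open>Q\<close> is minimal above \<open>P\<close>, then every nonzero \<open>b \<in> J\<close> has a divisor
    \<open>b' \<in> J\<close> with \<open>b/b' \<in> Q\<close>. As \<open>Q/P\<close> is archimedean, comparing powers of \<open>a/b\<close> with powers of a
    fixed \<open>t \<in> Q - P\<close> measures \<open>a/b\<close> by rational numbers, and one \<open>b\<close> for each \<open>(m, n)\<close> suffices.\<close>
  define K where "K P \<longleftrightarrow> (\<exists>a\<in>J - {\<zero>}. \<forall>b\<in>J. \<forall>c\<in>carrier R. a = b \<otimes> c \<longrightarrow> c \<notin> P)" for P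
  obtain a0 where "a0 \<in> J - {\<zero>}" using J(2) J.zero_closed by blast
  \<comment> \<open>A nonzero product has nonzero factors, so \<open>K\<close> holds at the zero
    ideal, which is prime in a domain; hence a maximal prime with \<open>K\<close> exists.\<close>
  then have "K {\<zero>}" unfolding K_def by (intro bexI[of _ a0]) auto
  then obtain P where P: "primeideal P R" "K P"
    and maximal: "\<And>Q. \<lbrakk>primeideal Q R; P \<subset> Q\<rbrakk> \<Longrightarrow> \<not> K Q"
    using exists_maximal_prime[of R "{\<zero>}" K, OF dim zeroprimeideal] by blast
  interpret P: primeideal P R by (rule P(1))
  obtain a where a: "a \<in> J" "a \<noteq> \<zero>" and notP: "\<And>b c. \<lbrakk>b \<in> J; c \<in> carrier R; a = b \<otimes> c\<rbrakk> \<Longrightarrow> c \<notin> P"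
    using P(2) unfolding K_def by blast
  have aR: "a \<in> carrier R" using a by simp
  show ?thesis
  proof (cases "\<forall>j\<in>J. a divides j")
    case True
    then show ?thesis using a by (intro exI[of _ "\<lambda>_ _. a"]) auto
  next
    case False
    then obtain b0 where b0: "b0 \<in> J" "\<not> a divides b0" by blast
    then have "b0 divides a" using divides_total[OF aR, of b0] by auto
    then obtain c0 where c0: "c0 \<in> carrier R" "a = b0 \<otimes> c0" by (rule dividesE)
    \<comment> \<open>The quotient \<open>c0\<close> is a nonunit outside \<open>P\<close>, so
      \<open>P\<close> lies strictly below the prime \<open>N\<close> of nonunits; the search for
      \<open>Q\<close> starts there.\<close>
    define N where "N = {x \<in> carrier R. \<not> x divides \<one>}"
    have N: "primeideal N R" unfolding N_def by (rule primeideal_nonunits)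
    have "\<not> c0 divides \<one>"
    proof
      assume "c0 divides \<one>"
      then obtain e where e: "e \<in> carrier R" "\<one> = c0 \<otimes> e" by (rule dividesE)
      then have "b0 = a \<otimes> e" using c0 b0 by (simp add: m_assoc flip: e(2))
      then show False using b0(2) dividesI[OF e(1)] by simp
    qed
    then have "c0 \<in> N" using c0 by (simp add: N_def)
    moreover have "\<one> \<notin> P" using P.one_imp_carrier P.I_notcarr by blast
    then have "P \<subseteq> N"
      using ideal_divides_closed[OF P.ideal_axioms, of _ \<one>] P.a_subset unfolding N_def by blast
    ultimately have "P \<subset> N" using notP[OF b0(1) c0] by blast
    from exists_minimal_prime[of R N "\<lambda>Q. P \<subset> Q", OF dim N this]
    obtain Q where Q: "primeideal Q R" "P \<subset> Q"
      and "\<forall>P'. primeideal P' R \<longrightarrow> P' \<subset> Q \<longrightarrow> \<not> P \<subset> P'"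
      by (elim exE conjE)
    then have minimal: "\<not> P' \<subset> Q" if "primeideal P' R" "P \<subset> P'" for P'
      using that by iprover
    interpret Q: primeideal Q R by (rule Q(1))
    obtain t where t: "t \<in> Q" "t \<notin> P" using Q(2) by blast
    have tR: "t \<in> carrier R" using t by simp
    \<comment> \<open>With v the valuation, \<open>W m n b\<close> says n v(a/b) \<ge> m
      v(t).\<close>
    define W where "W m n b \<longleftrightarrow> b \<in> J \<and> (\<exists>s\<in>carrier R. a = b \<otimes> s \<and> t [^] m divides s [^] n)"
      for m n :: nat and b
    \<comment> \<open>The default \<open>a\<close> keeps \<open>g m n\<close> a nonzero element of
      \<open>J\<close> when no \<open>b\<close> qualifies.\<close>
    define g where "g m n = (if \<exists>b. W m n b then SOME b. W m n b else a)" for m n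
    have gW: "W m n (g m n)" if "W m n b" for m n b
      using someI_ex[of "W m n"] that by (auto simp: g_def)
    have "g m n \<in> J - {\<zero>}" for m n
    proof (cases "\<exists>b. W m n b")
      case True
      then have "W m n (g m n)" using gW by blast
      then show ?thesis using a by (auto simp: W_def)
    qed (use a in \<open>simp add: g_def\<close>)
    \<comment> \<open>Since \<open>K\<close> fails at \<open>Q\<close>, \<open>b\<close> has a
      divisor \<open>b'\<close> in \<open>J\<close> with quotient \<open>c\<close> in
      \<open>Q\<close>. This leaves room for a rational multiple (m+1)/n of v(t) between v(s) and
      v(c s).\<close>
    moreover have key: "\<exists>m n. g m n divides b" if b: "b \<in> J" "s \<in> carrier R" "a = b \<otimes> s" for b s
    proof -
      have bR: "b \<in> carrier R" using b by simp
      have "b \<noteq> \<zero>" using a b by auto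
      then obtain b' c where c: "b' \<in> J" "c \<in> Q" "b = b' \<otimes> c"
        using maximal[OF Q] b(1) unfolding K_def by blast
      have cR: "c \<in> carrier R" "b' \<in> carrier R" using c by simp_all
      have acs: "a = b' \<otimes> (c \<otimes> s)" using b c cR by (simp add: m_assoc)
      then have "c \<otimes> s \<notin> P" using notP[OF c(1) _ acs] b cR by simp
      then have "c \<notin> P" using b P.I_r_closed by blast
      then have "t \<notin> {x \<in> carrier R. \<forall>n::nat. c [^] n divides x}"
        using Inter_powers_subset_prime[OF P(1) Q(1) minimal c(2)] t by blast
      \<comment> \<open>This exponent gives n v(c) \<ge> v(t).\<close>
      then obtain n :: nat where n: "\<not> c [^] n divides t" using tR by auto
      have "0 < n"
      proof (rule ccontr)
        assume "\<not> 0 < n"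
        then show False using n tR by (auto intro: dividesI[of t])
      qed
      have tc: "t divides c [^] n" using n divides_total[of t "c [^] n"] tR cR by simp
      have "s [^] n \<notin> P" using primeideal_pow_notin[OF P(1) b(2) notP[OF b]] .
      then have "s [^] n \<notin> {x \<in> carrier R. \<forall>n::nat. t [^] n divides x}"
        using Inter_powers_subset_prime[OF P(1) Q(1) minimal t] by blast
      then obtain k :: nat where k: "\<not> t [^] k divides s [^] n" using b(2) by auto
      \<comment> \<open>The exponent \<open>m\<close> is the largest with m v(t) \<le> n v(s), so n
        v(s) \<le> (m+1) v(t) \<le> n v(c s).\<close>
      have "t [^] (0::nat) divides s [^] n" using b(2) by (auto intro: dividesI[of "s [^] n"])
      then obtain m where m: "t [^] m divides s [^] n" "\<not> t [^] Suc m divides s [^] n"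
        using k by (induction k) auto
      have st: "s [^] n divides t [^] Suc m"
        using m(2) divides_total[of "s [^] n" "t [^] Suc m"] b(2) tR by simp
      have "t [^] Suc m divides s [^] n \<otimes> c [^] n"
      proof -
        obtain e f where "e \<in> carrier R" "s [^] n = t [^] m \<otimes> e" "f \<in> carrier R" "c [^] n = t \<otimes> f"
          using m(1) tc by (elim dividesE)
        then show ?thesis using tR by (intro dividesI[of "e \<otimes> f"]) (simp_all add: m_ac)
      qed
      also have "s [^] n \<otimes> c [^] n = (c \<otimes> s) [^] n"
        using b(2) cR by (simp add: nat_pow_distrib m_comm)
      finally have "W (Suc m) n b'"
        unfolding W_def using c(1) acs b(2) cR by (intro conjI bexI[of _ "c \<otimes> s"]) simp_all
      then have "W (Suc m) n (g (Suc m) n)" by (rule gW)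
      then obtain s' where s': "g (Suc m) n \<in> J" "s' \<in> carrier R" "a = g (Suc m) n \<otimes> s'"
          "t [^] Suc m divides s' [^] n" unfolding W_def by blast
      have gR: "g (Suc m) n \<in> carrier R" using s' by simp
      \<comment> \<open>The selected generator has quotient \<open>s'\<close> with n v(s') \<ge>
        (m+1) v(t) \<ge> n v(s). As both quotients have numerator \<open>a\<close>, the generator
        divides \<open>b\<close>.\<close>
      have "s [^] n divides s' [^] n"
        using divides_trans[OF st s'(4)] b(2) by simp
      then have "s divides s'" using divides_if_pow_divides[OF b(2) s'(2) \<open>0 < n\<close>] by blast
      then obtain e where e: "e \<in> carrier R" "s' = s \<otimes> e" by (rule dividesE)
      have "s \<noteq> \<zero>" using a b bR by auto
      moreover have "b \<otimes> s = (g (Suc m) n \<otimes> e) \<otimes> s"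
        using b(3) s'(3) e gR b(2) by (simp add: m_ac)
      ultimately have "b = g (Suc m) n \<otimes> e"
        using m_rcancel[of s b "g (Suc m) n \<otimes> e"] b(2) bR gR e by simp
      then show ?thesis using dividesI[OF e(1)] by blast
    qed
    \<comment> \<open>An element not dividing \<open>a\<close> is a multiple of \<open>a\<close>, so
      \<open>key\<close> for \<open>a\<close> itself, with quotient one, covers it.\<close>
    have "\<exists>m n. g m n divides j" if "j \<in> J" for j
    proof (cases "j divides a")
      case True
      then obtain s where "s \<in> carrier R" "a = j \<otimes> s" by (rule dividesE)
      then show ?thesis using key[OF that] by blast
    next
      case False
      then have aj: "a divides j" using divides_total[OF aR, of j] that by auto
      obtain m n where "g m n divides a" using key[OF a(1) one_closed] aR by auto
      then have "g m n divides j"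
        using aj J.Icarr \<open>\<And>m n. g m n \<in> J - {\<zero>}\<close> by (meson DiffD1 divides_trans)
      then show ?thesis by blast
    qed
    with \<open>\<And>m n. g m n \<in> J - {\<zero>}\<close> show ?thesis by (intro exI[of _ g]) blast
  qed
qed

text \<open>Enumerate the generators and keep a running common divisor: of the current term and the
  next generator, one that divides the other.\<close>

lemma ideal_chain_generated:
  assumes "krull_dim R < \<infinity>" "ideal J R" "J \<noteq> {\<zero>}"
  shows "\<exists>a :: nat \<Rightarrow> 'a. (\<forall>k. a k \<in> J - {\<zero>} \<and> a (Suc k) divides a k) \<and> (\<forall>j\<in>J. \<exists>k. a k divides j)"
proof -
  interpret J: ideal J R by fact
  obtain g :: "nat \<Rightarrow> nat \<Rightarrow> 'a" where g: "\<And>m n. g m n \<in> J - {\<zero>}" "\<And>j. j \<in> J \<Longrightarrow> \<exists>m n. g m n divides j"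
    using ideal_countably_generated[OF assms] by blast
  define h where "h k = (case prod_decode k of (m, n) \<Rightarrow> g m n)" for k
  have h: "h k \<in> J - {\<zero>}" for k using g(1) by (simp add: h_def split: prod.split)
  have hc: "h k \<in> carrier R" for k using h[of k] by simp
  define a where "a = rec_nat (h 0) (\<lambda>k x. if x divides h (Suc k) then x else h (Suc k))"
  have a0: "a 0 = h 0" and aS: "a (Suc k) = (if a k divides h (Suc k) then a k else h (Suc k))" for k
    by (simp_all add: a_def)
  have aJ: "a k \<in> J - {\<zero>}" for k
    by (induction k) (use h in \<open>auto simp: a0 aS\<close>)
  then have ac: "a k \<in> carrier R" for k by simp
  have div: "a (Suc k) divides a k" for k
    using divides_total[OF ac[of k] hc[of "Suc k"]] ac by (auto simp: aS)
  have ah: "a k divides h k" for k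
    by (cases k) (use hc in \<open>auto simp: a0 aS\<close>)
  have "\<exists>k. a k divides j" if j: "j \<in> J" for j
  proof -
    obtain m n where "g m n divides j" using g(2) j by blast
    then have "h (prod_encode (m, n)) divides j" by (simp add: h_def)
    then show ?thesis using ah ac hc by (meson divides_trans)
  qed
  then show ?thesis using aJ div by blast
qed

end

section \<open>Torsion submodules and trivial cohomology\<close>

lemma (in cring) ideal_pow_is_ideal:
  assumes "ideal I R"
  shows "ideal (I [^]\<^bsub>ideals_set R\<^esub> (n::nat)) R"
proof -
  interpret ids: comm_monoid "ideals_set R" by (rule ideals_set_is_comm_monoid)
  show ?thesis using ids.nat_pow_closed[of I n] assms by (simp add: ideals_set_def)
qed

lemma (in cring) ideal_pow_antimono:
  assumes "ideal I R" "m \<le> (n::nat)"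
  shows "I [^]\<^bsub>ideals_set R\<^esub> n \<subseteq> I [^]\<^bsub>ideals_set R\<^esub> m"
proof -
  interpret ids: comm_monoid "ideals_set R" by (rule ideals_set_is_comm_monoid)
  obtain k where n: "n = m + k" using \<open>m \<le> n\<close> le_Suc_ex by blast
  have "I [^]\<^bsub>ideals_set R\<^esub> n = (I [^]\<^bsub>ideals_set R\<^esub> m) \<cdot> (I [^]\<^bsub>ideals_set R\<^esub> k)"
    using ids.nat_pow_mult[of I m k] assms by (simp add: n ideals_set_def)
  then show ?thesis
    using ideal_prod_inter[OF ideal_pow_is_ideal ideal_pow_is_ideal] assms(1) by blast
qed

lemma torsion_simps [simp]:
  "add (torsion R I M) = add M" "zero (torsion R I M) = zero M"
  by (simp_all add: torsion_def)

text \<open>Powers of an ideal decrease, so the larger exponent serves both elements.\<close>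

lemma torsion_common_power:
  assumes "cring R" "ideal I R" "x \<in> carrier (torsion R I M)" "y \<in> carrier (torsion R I M)"
  obtains n :: nat where "1 \<le> n"
    "\<And>a. a \<in> I [^]\<^bsub>ideals_set R\<^esub> n \<Longrightarrow> a \<odot>\<^bsub>M\<^esub> x = \<zero>\<^bsub>M\<^esub> \<and> a \<odot>\<^bsub>M\<^esub> y = \<zero>\<^bsub>M\<^esub>"
proof -
  obtain k l :: nat where kl: "1 \<le> k" "\<forall>a\<in>I [^]\<^bsub>ideals_set R\<^esub> k. a \<odot>\<^bsub>M\<^esub> x = \<zero>\<^bsub>M\<^esub>"
      "\<forall>a\<in>I [^]\<^bsub>ideals_set R\<^esub> l. a \<odot>\<^bsub>M\<^esub> y = \<zero>\<^bsub>M\<^esub>"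
    using assms(3,4) by (auto simp: torsion_def)
  have "I [^]\<^bsub>ideals_set R\<^esub> max k l \<subseteq> I [^]\<^bsub>ideals_set R\<^esub> k"
      "I [^]\<^bsub>ideals_set R\<^esub> max k l \<subseteq> I [^]\<^bsub>ideals_set R\<^esub> l"
    using cring.ideal_pow_antimono[OF assms(1,2)] by simp_all
  then show thesis using kl by (intro that[of "max k l"]) auto
qed

lemma torsion_closed:
  assumes "Module.module R M" "ideal I R" "x \<in> carrier (torsion R I M)" "y \<in> carrier (torsion R I M)"
  shows "x \<oplus>\<^bsub>M\<^esub> y \<in> carrier (torsion R I M)" "x \<ominus>\<^bsub>M\<^esub> y \<in> carrier (torsion R I M)"
proof -
  interpret M: Module.module R M by fact
  have c: "x \<in> carrier M" "y \<in> carrier M" using assms(3,4) by (auto simp: torsion_def)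
  obtain n :: nat where n: "1 \<le> n"
    "\<And>a. a \<in> I [^]\<^bsub>ideals_set R\<^esub> n \<Longrightarrow> a \<odot>\<^bsub>M\<^esub> x = \<zero>\<^bsub>M\<^esub> \<and> a \<odot>\<^bsub>M\<^esub> y = \<zero>\<^bsub>M\<^esub>"
    using torsion_common_power[OF M.R.cring_axioms assms(2-4)] by blast
  have R: "a \<in> carrier R" if "a \<in> I [^]\<^bsub>ideals_set R\<^esub> n" for a
    using ideal.Icarr[OF M.R.ideal_pow_is_ideal[OF assms(2)] that] .
  show "x \<oplus>\<^bsub>M\<^esub> y \<in> carrier (torsion R I M)" "x \<ominus>\<^bsub>M\<^esub> y \<in> carrier (torsion R I M)"
    using c n R
    by (auto simp: torsion_def M.minus_eq M.smult_r_distr M.smult_r_minus intro!: exI[of _ n])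
qed

text \<open>Translation by an element of \<open>B\<close> maps \<open>B\<close> into itself by
  \<open>add\<close> and onto itself by \<open>diff\<close>, so every coset of a cocycle collapses
  to \<open>B\<close>. Both conditions speak of addition alone and thus apply directly to torsion
  records.\<close>

lemma cohomology_module_trivial:
  fixes C :: "nat \<Rightarrow> ('a, 'e) module" and d :: "nat \<Rightarrow> 'e \<Rightarrow> 'e" and j :: nat
  defines "Z \<equiv> linear_kernel (C (Suc j)) (C (Suc (Suc j))) (d (Suc j))"
    and "B \<equiv> d j ` carrier (C j)"
  assumes "Z \<noteq> {}" "Z \<subseteq> B"
    and add: "\<And>x y. \<lbrakk>x \<in> B; y \<in> B\<rbrakk> \<Longrightarrow> x \<oplus>\<^bsub>C (Suc j)\<^esub> y \<in> B"
    and diff: "\<And>x y. \<lbrakk>x \<in> B; y \<in> B\<rbrakk> \<Longrightarrow> \<exists>z\<in>B. x = z \<oplus>\<^bsub>C (Suc j)\<^esub> y"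
  shows "carrier (cohomology_module C d (Suc j)) = {\<zero>\<^bsub>cohomology_module C d (Suc j)\<^esub>}"
proof -
  have B: "coboundaries C d (Suc j) = B" by (simp add: coboundaries_def B_def)
  have "(\<Union>b\<in>B. {b \<oplus>\<^bsub>C (Suc j)\<^esub> x}) = B" if "x \<in> Z" for x
    using add diff that \<open>Z \<subseteq> B\<close> by blast
  then have "(\<Union>x\<in>Z. {\<Union>b\<in>B. {b \<oplus>\<^bsub>C (Suc j)\<^esub> x}}) = {B}"
    using \<open>Z \<noteq> {}\<close> by auto
  then show ?thesis
    unfolding cohomology_module_def quotient_module_def B A_RCOSETS_def RCOSETS_def r_coset_def
    by (simp add: Z_def)
qed

theorem theorem5p2:
  fixes V :: "('a, 'b) ring_scheme" and I :: "'a set"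
    and M :: "('a, 'm, 'c) module_scheme"
    and E :: "nat \<Rightarrow> ('a, 'e) module" and d :: "nat \<Rightarrow> 'e \<Rightarrow> 'e" and \<epsilon> :: "'m \<Rightarrow> 'e"
    and i :: nat
  assumes "valuation_ring V" and "krull_dim V < \<infinity>" and "ideal I V"
    and "Module.module V M" and "injective_resolution V M \<epsilon> E d"
    and "i \<ge> 3"
  shows "carrier (torsion_cohomology V I E d i) = {\<zero>\<^bsub>torsion_cohomology V I E d i\<^esub>}"
proof -
  interpret V: valuation_ring V by fact
  obtain p where i: "i = Suc (Suc (Suc p))"
    using \<open>i \<ge> 3\<close> le_Suc_ex[of 3 i] by (auto simp: numeral_3_eq_3)
  \<comment> \<open>\<open>r\<close> is \<open>i - 1\<close>, the degree of a preimage of a cocycle;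
    it has the form \<open>p + 2\<close> that \<open>cocycle_lift\<close> asks for.\<close>
  define r where "r = Suc (Suc p)"
  have inj: "injective_module V (E n)" and d: "d n \<in> linear_maps V (E n) (E (Suc n))"
    and exact: "d n ` carrier (E n) = linear_kernel (E (Suc n)) (E (Suc (Suc n))) (d (Suc n))" for n
    using assms(5) by (simp_all add: injective_resolution_def)
  have mE: "Module.module V (E n)" for n using inj by (simp add: injective_module_def)
  interpret S: Module.module V "E r" by (rule mE)
  interpret T: Module.module V "E (Suc r)" by (rule mE)
  have tc: "x \<in> carrier (E n)" if "x \<in> carrier (torsion V I (E n))" for x n
    using that by (simp add: torsion_def)
  define C where "C = (\<lambda>n. torsion V I (E n))"
  have "carrier (cohomology_module C d (Suc r)) = {\<zero>\<^bsub>cohomology_module C d (Suc r)\<^esub>}"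
  proof (rule cohomology_module_trivial)
    have "d (Suc r) \<zero>\<^bsub>E (Suc r)\<^esub> = \<zero>\<^bsub>E (Suc (Suc r))\<^esub>"
    proof -
      interpret U: Module.module V "E (Suc (Suc r))" by (rule mE)
      show ?thesis
        using linear_mapsD(3)[OF d[of "Suc r"], of "\<zero>\<^bsub>V\<^esub>" "\<zero>\<^bsub>E (Suc r)\<^esub>"]
          linear_mapsD(1)[OF d[of "Suc r"], of "\<zero>\<^bsub>E (Suc r)\<^esub>"] by simp
    qed
    moreover have "\<zero>\<^bsub>E (Suc r)\<^esub> \<in> carrier (C (Suc r))"
      using ideal.Icarr[OF V.ideal_pow_is_ideal[OF assms(3)]]
      by (auto simp: C_def torsion_def intro!: exI[of _ 1])
    ultimately show "linear_kernel (C (Suc r)) (C (Suc (Suc r))) (d (Suc r)) \<noteq> {}"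
      by (auto simp: linear_kernel_def C_def)
  next
    show "linear_kernel (C (Suc r)) (C (Suc (Suc r))) (d (Suc r)) \<subseteq> d r ` carrier (C r)"
    proof
      fix x assume x: "x \<in> linear_kernel (C (Suc r)) (C (Suc (Suc r))) (d (Suc r))"
      then have "x \<in> linear_kernel (E (Suc r)) (E (Suc (Suc r))) (d (Suc r))"
        using tc by (simp add: linear_kernel_def C_def)
      \<comment> \<open>Exactness of the resolution yields a preimage, but it may fail to be
        torsion.\<close>
      then obtain y0 where y0: "y0 \<in> carrier (E r)" "x = d r y0" using exact[of r] by blast
      obtain n :: nat where n: "n \<ge> 1" "\<And>a. a \<in> I [^]\<^bsub>ideals_set V\<^esub> n \<Longrightarrow> a \<odot>\<^bsub>E (Suc r)\<^esub> x = \<zero>\<^bsub>E (Suc r)\<^esub>"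
        using x by (auto simp: linear_kernel_def C_def torsion_def)
      \<comment> \<open>A preimage killed by this same power of \<open>I\<close> is sought, so that
        \<open>n\<close> also witnesses its torsion.\<close>
      define J where "J = I [^]\<^bsub>ideals_set V\<^esub> n"
      have J: "ideal J V" unfolding J_def by (rule V.ideal_pow_is_ideal[OF assms(3)])
      have "\<exists>y\<in>carrier (E r). d r y = x \<and> (\<forall>j\<in>J. j \<odot>\<^bsub>E r\<^esub> y = \<zero>\<^bsub>E r\<^esub>)"
      proof (cases "J = {\<zero>\<^bsub>V\<^esub>}")
        \<comment> \<open>The zero ideal kills everything, so \<open>y0\<close> itself
          serves.\<close>
        case True
        then show ?thesis using y0 by auto
      next
        case False
        obtain a where a: "\<And>k::nat. a k \<in> J - {\<zero>\<^bsub>V\<^esub>}" "\<And>k. a (Suc k) divides\<^bsub>V\<^esub> a k"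
            "\<And>j. j \<in> J \<Longrightarrow> \<exists>k. a k divides\<^bsub>V\<^esub> j"
          using V.ideal_chain_generated[OF assms(2) J False] by blast
        have aV: "a k \<in> carrier V - {\<zero>\<^bsub>V\<^esub>}" for k using a(1)[of k] ideal.Icarr[OF J] by auto
        have "a k \<odot>\<^bsub>E (Suc r)\<^esub> d r y0 = \<zero>\<^bsub>E (Suc r)\<^esub>" for k
          using n(2) a(1)[of k] y0(2) by (simp add: J_def)
        with y0(1) have "\<exists>y\<in>carrier (E r). d r y = d r y0 \<and> (\<forall>k. a k \<odot>\<^bsub>E r\<^esub> y = \<zero>\<^bsub>E r\<^esub>)"
          unfolding r_def by (intro cocycle_lift[where a = a and d = d and E = E and p = p, OF V.domain_axioms inj d exact aV a(2)])
        then obtain y where y: "y \<in> carrier (E r)" "d r y = x" "\<And>k. a k \<odot>\<^bsub>E r\<^esub> y = \<zero>\<^bsub>E r\<^esub>"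
          using y0(2) by auto
        \<comment> \<open>Every element of \<open>J\<close> is a multiple of some
          \<open>a k\<close>, so being killed by the chain suffices.\<close>
        have "j \<odot>\<^bsub>E r\<^esub> y = \<zero>\<^bsub>E r\<^esub>" if j: "j \<in> J" for j
        proof -
          obtain k where "a k divides\<^bsub>V\<^esub> j" using a(3) j by blast
          then obtain c where c: "c \<in> carrier V" "j = a k \<otimes>\<^bsub>V\<^esub> c" by (rule dividesE)
          then have "j = c \<otimes>\<^bsub>V\<^esub> a k" using aV[of k] V.m_comm by simp
          then show ?thesis using c y aV[of k] by (simp add: S.smult_assoc1)
        qed
        then show ?thesis using y by blast
      qed
      then show "x \<in> d r ` carrier (C r)"
        using n(1) by (auto simp: C_def torsion_def J_def)
    qed
  next
    fix x y assume "x \<in> d r ` carrier (C r)" "y \<in> d r ` carrier (C r)"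
    then obtain u v where uv: "u \<in> carrier (torsion V I (E r))" "v \<in> carrier (torsion V I (E r))"
        "x = d r u" "y = d r v" by (auto simp: C_def)
    note c = tc[OF uv(1)] tc[OF uv(2)] and t = torsion_closed[OF mE assms(3) uv(1,2)]
    have "x \<oplus>\<^bsub>C (Suc r)\<^esub> y = d r (u \<oplus>\<^bsub>E r\<^esub> v)"
      using uv c by (simp add: C_def linear_mapsD(2)[OF d])
    then show "x \<oplus>\<^bsub>C (Suc r)\<^esub> y \<in> d r ` carrier (C r)" using t by (simp add: C_def)
    have "x = d r (u \<ominus>\<^bsub>E r\<^esub> v) \<oplus>\<^bsub>C (Suc r)\<^esub> y"
      using uv c linear_mapsD(1)[OF d[of r]]
      by (simp add: C_def linear_maps_minus[OF mE mE d] T.minus_eq T.a_assoc T.l_neg)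
    then show "\<exists>z\<in>d r ` carrier (C r). x = z \<oplus>\<^bsub>C (Suc r)\<^esub> y" using t by (auto simp: C_def)
  qed
  then show ?thesis by (simp add: torsion_cohomology_def C_def i r_def)
qed

end
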